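(* Let $\gamma>0$ and let $(X_1(n),X_2(n),\dots)_{n\ge0}$ be the central Markov chain corresponding to the Chinese restaurant process with parameter $\gamma$. Let $X_{(1)}(n)\ge X_{(2)}(n)\ge\cdots$ be the order statistics of $(X_1(n),X_2(n),\dots)$. Then, as $n$ tends to infinity, $$\left(\frac{X_{(i)}(n)}{n}\right)_{i\ge1}\Longrightarrow \mathrm{PD}(0,\gamma)$$ in distribution.
   Context: The chain takes values in finite sequences $(x_1,\dots,x_k)$ of positive integers, $k\ge1$ (group sizes, padded with zeros when seen as infinite sequences), and starts from $(1)$ at time $0$. Given a current state $(x_1,\dots,x_k)$ with $x_1+\cdots+x_k=m$, its transition probabilities are: to $(x_1,\dots,x_i+1,\dots,x_k)$ with probability $\frac{x_i}{m+\gamma}$ for $1\le i\le k$, and to $(x_1,\dots,x_k,1)$ with probability $\frac{\gamma}{m+\gamma}$. Thus the sum of the coordinates at time $n$ is $n+1$. $\mathrm{PD}(0,\gamma)$ (Poisson–Dirichlet distribution, Kingman's law with parameter $\gamma$) is the law of the decreasing rearrangement $\theta_{(1)}>\theta_{(2)}>\cdots$ of $(\theta_n)_{n\ge1}$, where $\theta_n=U_n(1-U_{n-1})\cdots(1-U_1)$ and $(U_n)_{n\ge1}$ are i.i.d. $\mathrm{Beta}(1,\gamma)$ random variables. Convergence in distribution is for random sequences in $[0,\infty)^{\mathbb N}$ with the product topology. *)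

theory Defs
  imports "HOL-Probability.Probability"
begin

text \<open>All sequences are indexed from 0, so the usual \<open>X\<^sub>1, X\<^sub>2, \<dots>\<close> and \<open>U\<^sub>1, U\<^sub>2, \<dots>\<close> have
  indices \<open>0, 1, \<dots>\<close> here.\<close>

text \<open>The process is prescribed by its finite-dimensional distributions.  Multiplying out the
  conditional probabilities avoids conditioning on null events.\<close>

definition markov_chain ::
  "'a measure \<Rightarrow> 's \<Rightarrow> ('s \<Rightarrow> 's \<Rightarrow> real) \<Rightarrow> (nat \<Rightarrow> 'a \<Rightarrow> 's) \<Rightarrow> bool" where
  "markov_chain M x0 p X \<longleftrightarrow>
     prob_space M \<and>
     (\<forall>n. X n \<in> M \<rightarrow>\<^sub>M count_space UNIV) \<and>
     (AE \<omega> in M. X 0 \<omega> = x0) \<and>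
     (\<forall>n s. measure M {\<omega> \<in> space M. \<forall>k\<le>Suc n. X k \<omega> = s k} =
            measure M {\<omega> \<in> space M. \<forall>k\<le>n. X k \<omega> = s k} * p (s n) (s (Suc n)))"

text \<open>For a state with positive entries the \<open>length xs + 1\<close> possible successors are pairwise
  distinct, so for each \<open>ys\<close> at most one summand is nonzero.\<close>

definition crp_transition :: "real \<Rightarrow> nat list \<Rightarrow> nat list \<Rightarrow> real" where
  "crp_transition \<gamma> xs ys =
     (\<Sum>i<length xs. if ys = xs[i := xs ! i + 1]
                     then real (xs ! i) / (real (sum_list xs) + \<gamma>) else 0) +
     (if ys = xs @ [1] then \<gamma> / (real (sum_list xs) + \<gamma>) else 0)"

definition crp_chain :: "'a measure \<Rightarrow> real \<Rightarrow> (nat \<Rightarrow> 'a \<Rightarrow> nat list) \<Rightarrow> bool" where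
  "crp_chain M \<gamma> X \<longleftrightarrow> markov_chain M [1] (crp_transition \<gamma>) X"

definition pad :: "nat list \<Rightarrow> nat \<Rightarrow> real" where
  "pad xs i = (if i < length xs then real (xs ! i) else 0)"

definition is_decreasing_rearrangement :: "(nat \<Rightarrow> real) \<Rightarrow> (nat \<Rightarrow> real) \<Rightarrow> bool" where
  "is_decreasing_rearrangement x y \<longleftrightarrow> antimono y \<and> (\<exists>\<sigma>. bij \<sigma> \<and> y = x \<circ> \<sigma>)"

lemma is_decreasing_rearrangement_unique:
  assumes "is_decreasing_rearrangement x y" "is_decreasing_rearrangement x z"
  shows "y = z"
proof -
  have le: "y i \<le> z i"
    if y: "is_decreasing_rearrangement x y" and z: "is_decreasing_rearrangement x z" for y z i
  proof (rule ccontr)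
    assume less: "\<not> y i \<le> z i"
    obtain \<sigma> where \<sigma>: "bij \<sigma>" "y = x \<circ> \<sigma>" and "antimono y"
      using y by (auto simp: is_decreasing_rearrangement_def)
    obtain \<tau> where \<tau>: "bij \<tau>" "z = x \<circ> \<tau>" and "antimono z"
      using z by (auto simp: is_decreasing_rearrangement_def)
    let ?f = "inv \<tau> \<circ> \<sigma>"
    have inj: "inj ?f"
      using \<sigma> \<tau> by (meson bij_comp bij_imp_bij_inv bij_is_inj)
    have "?f ` {..i} \<subseteq> {..<i}"
    proof
      fix k assume "k \<in> ?f ` {..i}"
      then obtain j where j: "j \<le> i" "k = inv \<tau> (\<sigma> j)" by auto
      have "z k = y j"
        using j \<sigma> \<tau> by (simp add: bij_is_surj surj_f_inv_f)
      also have "\<dots> \<ge> y i"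
        using \<open>antimono y\<close> j by (simp add: antimonoD)
      finally have "z k > z i"
        using less by simp
      then show "k \<in> {..<i}"
        using \<open>antimono z\<close> by (metis antimonoD lessThan_iff not_le)
    qed
    then have "card (?f ` {..i}) \<le> card {..<i}"
      by (intro card_mono) auto
    moreover have "card (?f ` {..i}) = card {..i}"
      using inj by (meson card_image inj_on_subset subset_UNIV)
    ultimately show False
      by simp
  qed
  show ?thesis
    by (rule ext, rule antisym) (use le assms in blast)+
qed

text \<open>A decreasing rearrangement exists iff for every \<open>i\<close> only finitely many terms exceed
  \<open>x i\<close>.  This covers every \<^term>\<open>pad xs\<close> (zeros included) and every positive null sequence; the
  fallback value 0 occurs in \<open>poisson_dirichlet\<close> only on a null set.\<close>

definition decreasing_rearrangement :: "(nat \<Rightarrow> real) \<Rightarrow> nat \<Rightarrow> real" where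
  "decreasing_rearrangement x =
     (if \<exists>y. is_decreasing_rearrangement x y
      then THE y. is_decreasing_rearrangement x y else (\<lambda>_. 0))"

definition beta_distribution :: "real \<Rightarrow> real \<Rightarrow> real measure" where
  "beta_distribution a b = density lborel
     (\<lambda>x. ennreal (indicator {0<..<1} x * (x powr (a - 1) * (1 - x) powr (b - 1) / Beta a b)))"

definition stick_breaking :: "(nat \<Rightarrow> real) \<Rightarrow> nat \<Rightarrow> real" where
  "stick_breaking u n = u n * (\<Prod>i<n. 1 - u i)"

text \<open>The product measure is the joint law of the independent \<open>Beta(1, \<gamma>)\<close> variables, and
  \<^const>\<open>borel\<close> on \<^typ>\<open>nat \<Rightarrow> real\<close> is that of the product topology.\<close>

definition poisson_dirichlet :: "real \<Rightarrow> (nat \<Rightarrow> real) measure" where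
  "poisson_dirichlet \<gamma> =
     distr (Pi\<^sub>M UNIV (\<lambda>_::nat. beta_distribution 1 \<gamma>)) borel
       (\<lambda>u. decreasing_rearrangement (stick_breaking u))"

text \<open>Weak convergence of Borel measures carried by a Borel subset \<open>S\<close>, as measures on the
  topological space \<open>S\<close>.\<close>

definition converges_weakly_on ::
  "'b::topological_space set \<Rightarrow> (nat \<Rightarrow> 'b measure) \<Rightarrow> 'b measure \<Rightarrow> bool" where
  "converges_weakly_on S \<mu> \<nu> \<longleftrightarrow>
     (\<forall>f :: 'b \<Rightarrow> real. continuous_on S f \<longrightarrow> bounded (f ` S) \<longrightarrow>
        (\<lambda>n. LINT x:S|\<mu> n. f x) \<longlonglongrightarrow> (LINT x:S|\<nu>. f x))"

end

theory Submission
  imports Defs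
begin

text \<open>The restaurant process is a mixture.  Given stick lengths \<open>P\<close> from \<open>Beta(1, \<gamma>)\<close> variables,
  let each step join an existing group \<open>i\<close> with probability \<open>P\<^sub>i\<close> and open the next group
  otherwise.  A path probability of this conditional chain depends only on the final state and is a
  product of powers of \<open>u\<^sub>i\<close> and \<open>1 - u\<^sub>i\<close>, so its mean is a product of Beta functions, which
  telescopes to the path probability of the restaurant process.  Given \<open>P\<close>, a second moment
  estimate gives \<open>X\<^sub>i(n) / n \<rightarrow> P\<^sub>i\<close> in probability.  As no mass is lost in the limit, this
  convergence is uniform in \<open>i\<close>, and sorting is 1-Lipschitz for the supremum distance.  Dominated
  convergence over \<open>P\<close> concludes.\<close>

section \<open>Decreasing rearrangements\<close>

text \<open>Sorting is not continuous for the product topology: mass can hide in ever later groups,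
  where no fixed coordinate sees it. Convergence of each coordinate alone is therefore too weak, and
  the total mass has to enter. The sticks are the limiting frequencies in order of appearance, a
  size-biased order; this is why the whole remaining stick is the chance of a new group. A group
  follows its own weight only once it is open, which obstructs a direct variance computation.
  Finally, no coupling of chain and sticks is built: weak convergence sees only the law at each
  time, so both processes enter through iterates of a one-step expectation operator, and the mixture
  is an identity between such iterates.\<close>

lemma is_decreasing_rearrangement_le_add:
  assumes xy: "is_decreasing_rearrangement x y" and xy': "is_decreasing_rearrangement x' y'"
    and le: "\<And>i. x i \<le> x' i + e"
  shows "y i \<le> y' i + e"
proof (rule ccontr)
  assume less: "\<not> y i \<le> y' i + e"
  obtain \<sigma> where \<sigma>: "bij \<sigma>" "y = x \<circ> \<sigma>" and "antimono y"
    using xy by (auto simp: is_decreasing_rearrangement_def)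
  obtain \<tau> where \<tau>: "bij \<tau>" "y' = x' \<circ> \<tau>" and "antimono y'"
    using xy' by (auto simp: is_decreasing_rearrangement_def)
  \<comment> \<open>\<open>?f\<close> sends a position in \<open>y\<close> to the position of the
    same index in \<open>y'\<close>. The entries of \<open>y'\<close> found there all exceed
    \<open>y' i\<close>, so \<open>i + 1\<close> positions would have to fit among the
    \<open>i\<close> positions before \<open>i\<close>.\<close>
  let ?f = "inv \<tau> \<circ> \<sigma>"
  have inj: "inj ?f"
    using \<sigma> \<tau> by (meson bij_comp bij_imp_bij_inv bij_is_inj)
  have "?f ` {..i} \<subseteq> {..<i}"
  proof
    fix k assume "k \<in> ?f ` {..i}"
    then obtain j where j: "j \<le> i" "k = inv \<tau> (\<sigma> j)" by auto
    have "y' k = x' (\<sigma> j)"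
      using j \<tau> by (simp add: bij_is_surj surj_f_inv_f)
    moreover have "y i \<le> x (\<sigma> j)"
      using antimonoD[OF \<open>antimono y\<close> \<open>j \<le> i\<close>] \<sigma> by simp
    ultimately have "y' k > y' i"
      using less le[of "\<sigma> j"] by simp
    then show "k \<in> {..<i}"
      using \<open>antimono y'\<close> by (metis antimonoD lessThan_iff not_le)
  qed
  then have "card (?f ` {..i}) \<le> card {..<i}"
    by (intro card_mono) auto
  moreover have "card (?f ` {..i}) = card {..i}"
    using inj by (meson card_image inj_on_subset subset_UNIV)
  ultimately show False
    by simp
qed

lemma decreasing_rearrangement_eqI:
  assumes "is_decreasing_rearrangement x y"
  shows "decreasing_rearrangement x = y"
proof -
  have "(THE z. is_decreasing_rearrangement x z) = y"
    using assms is_decreasing_rearrangement_unique by blast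
  then show ?thesis
    using assms by (auto simp: decreasing_rearrangement_def)
qed

text \<open>A sorted sequence places all terms larger than \<open>x i\<close> before
  \<open>x i\<close>, hence at finitely many positions. Conversely, finiteness gives every index a
  finite rank, and the rank is the inverse of the sorting permutation.\<close>

lemma ex_decreasing_rearrangement_iff:
  "(\<exists>y. is_decreasing_rearrangement x y) \<longleftrightarrow> (\<forall>i. finite {j. x i < x j})"
proof
  assume "\<exists>y. is_decreasing_rearrangement x y"
  then obtain y and \<sigma> :: "nat \<Rightarrow> nat" where y: "antimono y" "bij \<sigma>" "y = x \<circ> \<sigma>"
    by (auto simp: is_decreasing_rearrangement_def)
  show "\<forall>i. finite {j. x i < x j}"
  proof
    fix i
    obtain k where k: "\<sigma> k = i"
      using y(2) by (metis bij_pointE)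
    have "{j. x i < x j} \<subseteq> \<sigma> ` {..k}"
    proof
      fix j assume j: "j \<in> {j. x i < x j}"
      obtain l where l: "\<sigma> l = j"
        using y(2) by (metis bij_pointE)
      have "y k < y l"
        using j k l y(3) by simp
      then have "l \<le> k"
        using y(1) by (metis antimonoD linorder_not_less nat_le_linear)
      then show "j \<in> \<sigma> ` {..k}"
        using l by auto
    qed
    then show "finite {j. x i < x j}"
      by (rule finite_subset) simp
  qed
next
  assume fin: "\<forall>i. finite {j. x i < x j}"
  \<comment> \<open>\<open>P i\<close> holds the predecessors of \<open>i\<close> when larger values
    come first and ties are broken by index; its cardinality is the rank of
    \<open>i\<close>.\<close>
  define P where "P i = {j. x i < x j \<or> (x i = x j \<and> j < i)}" for i
  define r where "r i = card (P i)" for i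
  have finP: "finite (P i)" for i
    by (rule finite_subset[of _ "{j. x i < x j} \<union> {..<i}"]) (use fin in \<open>auto simp: P_def\<close>)
  have mono: "r j < r i" if "j \<in> P i" for i j
    unfolding r_def
  proof (rule psubset_card_mono[OF finP])
    have "P j \<subseteq> P i" "j \<notin> P j"
      using that by (auto simp: P_def)
    then show "P j \<subset> P i"
      using that by auto
  qed
  have total: "i = j \<or> i \<in> P j \<or> j \<in> P i" for i j
    unfolding P_def by (auto simp: linorder_neq_iff)
  have inj: "inj r"
    by (rule injI) (metis mono total less_irrefl)
  \<comment> \<open>\<open>r\<close> maps \<open>P i\<close> injectively into a set of the same
    size, so the ranks below \<open>r i\<close> are all taken. As \<open>r\<close> is unbounded,
    surjectivity follows.\<close>
  have img: "r ` P i = {..<r i}" for i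
  proof (rule card_subset_eq)
    show "card (r ` P i) = card {..<r i}"
      unfolding card_image[OF inj_on_subset[OF inj subset_UNIV]] by (simp add: r_def)
  qed (use mono in auto)

  have "n \<in> range r" for n
  proof -
    have "infinite (range r)"
      using inj by (simp add: finite_image_iff)
    then obtain i where "n < r i"
      unfolding infinite_nat_iff_unbounded by blast
    then have "n \<in> r ` P i"
      by (simp add: img)
    then show ?thesis
      by auto
  qed
  then have bij: "bij r"
    using inj by (auto simp: bij_def)
  have "x (inv r b) \<le> x (inv r a)" if "a \<le> b" for a b
  proof (rule ccontr)
    assume "\<not> x (inv r b) \<le> x (inv r a)"
    then have "inv r b \<in> P (inv r a)"
      by (simp add: P_def)
    from mono[OF this] show False
      using that bij by (simp add: bij_is_surj surj_f_inv_f)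
  qed
  then have "antimono (x \<circ> inv r)"
    by (simp add: antimono_def)
  moreover have "bij (inv r)"
    using bij by (rule bij_imp_bij_inv)
  ultimately show "\<exists>y. is_decreasing_rearrangement x y"
    unfolding is_decreasing_rearrangement_def by blast
qed

section \<open>Measurability of the sorting map\<close>

lemma less_decreasing_rearrangement_iff:
  assumes "is_decreasing_rearrangement x y"
  shows "t < y j \<longleftrightarrow> (\<exists>A. finite A \<and> card A = Suc j \<and> (\<forall>i\<in>A. t < x i))"
proof -
  obtain \<sigma> where \<sigma>: "bij \<sigma>" "y = x \<circ> \<sigma>" and anti: "antimono y"
    using assms by (auto simp: is_decreasing_rearrangement_def)
  have inj: "inj_on \<sigma> B" for B
    using \<sigma>(1) by (meson bij_is_inj inj_on_subset subset_UNIV)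
  show ?thesis
  proof
    assume t: "t < y j"
    have "t < x (\<sigma> k)" if "k \<le> j" for k
      using antimonoD[OF anti that] t \<sigma>(2) by simp
    then show "\<exists>A. finite A \<and> card A = Suc j \<and> (\<forall>i\<in>A. t < x i)"
      by (intro exI[of _ "\<sigma> ` {..j}"]) (auto simp: card_image[OF inj])
  next
    assume "\<exists>A. finite A \<and> card A = Suc j \<and> (\<forall>i\<in>A. t < x i)"
    then obtain A where A: "finite A" "card A = Suc j" "\<forall>i\<in>A. t < x i"
      by auto
    show "t < y j"
    proof (rule ccontr)
      assume nt: "\<not> t < y j"
      have "A \<subseteq> \<sigma> ` {..<j}"
      proof
        fix i assume i: "i \<in> A"
        obtain k where k: "\<sigma> k = i"
          using \<sigma>(1) by (metis bij_pointE)
        have "y j < y k"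
          using A(3) i k nt \<sigma>(2) by fastforce
        then have "k < j"
          using anti by (metis antimonoD not_le)
        then show "i \<in> \<sigma> ` {..<j}"
          using k by auto
      qed
      then have "card A \<le> card (\<sigma> ` {..<j})"
        by (intro card_mono) auto
      then show False
        using A(2) by (simp add: card_image[OF inj])
    qed
  qed
qed

text \<open>The definition ranges over uncountably many permutations. Order statistic
  \<open>j\<close> exceeds \<open>t\<close> iff some set of \<open>j + 1\<close> indices has all its
  entries above \<open>t\<close>, and there are only countably many such sets.\<close>

lemma measurable_decreasing_rearrangement: "decreasing_rearrangement \<in> borel_measurable borel"
proof (rule measurable_coordinatewise_then_product)
  fix j
  have coord: "(\<lambda>x. x i) \<in> borel_measurable borel" for i :: nat
    by (rule measurable_product_coordinates)
  \<comment> \<open>The domain on which a rearrangement exists. Finiteness is expressed by a bound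
    \<open>n\<close>, which leaves countable unions and intersections of coordinate
    comparisons.\<close>
  define E where "E = {x :: nat \<Rightarrow> real. \<forall>i. \<exists>n. \<forall>k\<ge>n. x k \<le> x i}"
  have E_iff: "(\<exists>y. is_decreasing_rearrangement x y) \<longleftrightarrow> x \<in> E" for x
  proof -
    have "finite {k. x i < x k} \<longleftrightarrow> (\<exists>n. \<forall>k\<ge>n. x k \<le> x i)" for i
      unfolding finite_nat_set_iff_bounded Ball_def mem_Collect_eq by (meson not_le)
    then show ?thesis
      by (simp add: ex_decreasing_rearrangement_iff E_def)
  qed
  have le: "{x :: nat \<Rightarrow> real. n \<le> k \<longrightarrow> x k \<le> x i} \<in> sets borel" for n k i
    using borel_measurable_le[OF coord[of k] coord[of i]] by (cases "n \<le> k") auto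
  have "E = (\<Inter>i. \<Union>n. \<Inter>k. {x. n \<le> k \<longrightarrow> x k \<le> x i})"
    by (auto simp: E_def)
  then have E: "E \<in> sets borel"
    by (simp only:) (intro sets.countable_INT'' sets.countable_UN'' countableI_type le; simp)
  define C where "C = {A :: nat set. finite A \<and> card A = Suc j}"
  have cC: "countable C"
    by (rule countable_subset[OF _ countable_Collect_finite]) (auto simp: C_def)
  show "(\<lambda>x. decreasing_rearrangement x j) \<in> borel_measurable borel"
    unfolding borel_measurable_iff_greater
  proof
    fix t
    \<comment> \<open>Off \<open>E\<close> the fallback value is 0, which exceeds \<open>t\<close>
      exactly when \<open>t < 0\<close>.\<close>
    have "{x. t < decreasing_rearrangement x j} =
      (E \<inter> (\<Union>A\<in>C. {x. \<forall>i\<in>A. t < x i})) \<union> (if t < 0 then - E else {})"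
      (is "_ = ?R")
    proof (rule set_eqI)
      fix x
      show "x \<in> {x. t < decreasing_rearrangement x j} \<longleftrightarrow> x \<in> ?R"
      proof (cases "x \<in> E")
        case True
        then obtain y where y: "is_decreasing_rearrangement x y"
          using E_iff by blast
        show ?thesis
          using True less_decreasing_rearrangement_iff[OF y, of t j] decreasing_rearrangement_eqI[OF y]
          by (auto simp: C_def)
      next
        case False
        then have "decreasing_rearrangement x = (\<lambda>_. 0)"
          using E_iff by (auto simp: decreasing_rearrangement_def)
        with False show ?thesis by auto
      qed
    qed
    moreover have "{x :: nat \<Rightarrow> real. \<forall>i\<in>A. t < x i} \<in> sets borel" if "A \<in> C" for A
    proof -
      have "{x. t < x i} \<in> sets borel" for i :: nat
        using borel_measurable_less[OF measurable_const[of t] coord[of i]] by simp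
      moreover have "{x :: nat \<Rightarrow> real. \<forall>i\<in>A. t < x i} = (\<Inter>i. if i \<in> A then {x. t < x i} else UNIV)"
        by auto
      ultimately show ?thesis
        by (simp only:) (intro sets.countable_INT''; simp)
    qed
    ultimately show "{x \<in> space borel. t < decreasing_rearrangement x j} \<in> sets borel"
      using cC E by (auto intro!: sets.countable_UN'' sets.Un sets.Int borel_comp)
  qed
qed

section \<open>Sorted states, and neighbourhoods in sequence space\<close>

lemma pad_nonneg: "0 \<le> pad xs i"
  by (simp add: pad_def)

text \<open>Division by \<open>n\<close> is monotone, so it commutes with sorting; for
  \<open>n = 0\<close> both sides are constantly 0.\<close>

lemma is_decreasing_rearrangement_pad_divide:
  "is_decreasing_rearrangement (\<lambda>i. pad xs i / real n)
     (\<lambda>i. decreasing_rearrangement (pad xs) i / real n)"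
proof -
  have "finite {j. pad xs i < pad xs j}" for i
    by (rule finite_subset[of _ "{..<length xs}"])
      (use pad_nonneg[of xs i] in \<open>auto simp: pad_def split: if_splits\<close>)
  then obtain y where y: "is_decreasing_rearrangement (pad xs) y"
    using ex_decreasing_rearrangement_iff by blast
  then have "is_decreasing_rearrangement (\<lambda>i. pad xs i / real n) (\<lambda>i. y i / real n)"
    by (auto simp: is_decreasing_rearrangement_def antimono_def divide_right_mono o_def)
  then show ?thesis
    by (simp add: decreasing_rearrangement_eqI[OF y])
qed

lemma sum_pad_le:
  assumes "finite A"
  shows "(\<Sum>i\<in>A. pad xs i) \<le> real (sum_list xs)"
proof -
  have "(\<Sum>i\<in>A. pad xs i) = (\<Sum>i\<in>A \<inter> {..<length xs}. pad xs i)"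
    by (rule sum.mono_neutral_right) (use assms in \<open>auto simp: pad_def\<close>)
  also have "\<dots> \<le> (\<Sum>i<length xs. pad xs i)"
    by (rule sum_mono2) (auto simp: pad_nonneg)
  also have "\<dots> = real (sum_list xs)"
    by (simp add: pad_def sum_list_sum_nth atLeast0LessThan)
  finally show ?thesis .
qed

lemma decreasing_rearrangement_pad_divide_nonneg:
  "0 \<le> decreasing_rearrangement (pad xs) i / real n"
  using is_decreasing_rearrangement_pad_divide[of xs n] pad_nonneg[of xs]
  by (auto simp: is_decreasing_rearrangement_def fun_eq_iff)

text \<open>A basic open set of the product topology restricts finitely many coordinates, so it
  contains a ball for the supremum distance. This is how uniform estimates reach a test
  function.\<close>

lemma continuous_on_uniform_neighbourhood:
  fixes f :: "(nat \<Rightarrow> real) \<Rightarrow> real"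
  assumes f: "continuous_on S f" and y: "y \<in> S" and d: "0 < d"
  obtains e where "0 < e"
    "\<And>x. x \<in> S \<Longrightarrow> (\<And>i. \<bar>x i - y i\<bar> \<le> e) \<Longrightarrow> \<bar>f x - f y\<bar> < d"
proof -
  have "open (ball (f y) d)" "f y \<in> ball (f y) d"
    using d by auto
  then obtain A where A: "open A" "y \<in> A" "\<And>x. x \<in> S \<Longrightarrow> x \<in> A \<Longrightarrow> f x \<in> ball (f y) d"
    using f y unfolding continuous_on_topological by metis
  from product_topology_open_contains_basis[of "\<lambda>_. euclidean" UNIV A y] A
  obtain X where X: "y \<in> Pi\<^sub>E UNIV X" "\<And>i. open (X i)" "finite {i. X i \<noteq> UNIV}" "Pi\<^sub>E UNIV X \<subseteq> A"
    by (auto simp: open_fun_def)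
  have "\<forall>i. \<exists>e>0. cball (y i) e \<subseteq> X i"
    using X(1,2) by (auto simp: PiE_def Pi_def open_contains_cball)
  then obtain r where r: "\<And>i. 0 < r i" "\<And>i. cball (y i) (r i) \<subseteq> X i"
    by metis
  \<comment> \<open>Inserting 1 keeps the minimum meaningful when no coordinate is
    restricted.\<close>
  define e where "e = Min (insert 1 (r ` {i. X i \<noteq> UNIV}))"
  have "0 < e"
    using X(3) r(1) by (auto simp: e_def)
  moreover have "\<bar>f x - f y\<bar> < d" if x: "x \<in> S" and close: "\<And>i. \<bar>x i - y i\<bar> \<le> e" for x
  proof -
    have "x i \<in> X i" for i
    proof (cases "X i = UNIV")
      case False
      then have "e \<le> r i"
        using X(3) by (auto simp: e_def)
      then have "x i \<in> cball (y i) (r i)"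
        using close[of i] by (auto simp: dist_real_def)
      then show ?thesis using r(2) by blast
    qed simp
    then have "x \<in> A"
      using X(4) by auto
    then have "f x \<in> ball (f y) d"
      using A(3) x by blast
    then show ?thesis
      by (simp add: dist_real_def abs_minus_commute)
  qed
  ultimately show ?thesis
    using that by blast
qed

lemma closed_nonneg_sequences: "closed {x :: nat \<Rightarrow> real. \<forall>i. 0 \<le> x i}"
  by (intro closed_Collect_all closed_Collect_le continuous_on_const continuous_on_product_coordinates)

section \<open>The law of large numbers for given weights\<close>

definition grow :: "nat list \<Rightarrow> nat \<Rightarrow> nat list" where
  "grow xs i = (if i < length xs then xs[i := xs ! i + 1] else xs @ [1])"

text \<open>The generator acting on functions of the state: \<open>(seat q ^^ n) g xs\<close> is the expectation of \<open>g\<close>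
  after \<open>n\<close> steps from \<open>xs\<close>.  The index \<open>length xs\<close> stands for opening a new group.\<close>

definition seat :: "(nat list \<Rightarrow> nat \<Rightarrow> real) \<Rightarrow> (nat list \<Rightarrow> real) \<Rightarrow> nat list \<Rightarrow> real" where
  "seat q h xs = (\<Sum>i\<le>length xs. q xs i * h (grow xs i))"

lemma sum_list_grow: "sum_list (grow xs i) = Suc (sum_list xs)"
  by (auto simp: grow_def sum_list_update)

lemma pad_grow:
  assumes "l \<le> length xs"
  shows "pad (grow xs l) i = pad xs i + (if i = l then 1 else 0)"
  using assms by (auto simp: pad_def grow_def nth_append)

lemma length_grow: "length (grow xs l) = (if l < length xs then length xs else Suc (length xs))"
  by (simp add: grow_def)

text \<open>Common ground of the conditional chain and the restaurant process: \<open>seat q\<close>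
  is then a positive operator that preserves constants.\<close>

locale seating =
  fixes q :: "nat list \<Rightarrow> nat \<Rightarrow> real"
  assumes nonneg: "i \<le> length xs \<Longrightarrow> 0 \<le> q xs i"
    and sum_eq_1: "(\<Sum>i\<le>length xs. q xs i) = 1"
begin

lemma seat_mono:
  assumes "\<And>i. i \<le> length xs \<Longrightarrow> g (grow xs i) \<le> h (grow xs i)"
  shows "seat q g xs \<le> seat q h xs"
  unfolding seat_def by (intro sum_mono mult_left_mono assms nonneg) auto

lemma seat_add_const: "seat q (\<lambda>xs. h xs + c) xs = seat q h xs + c"
  by (simp add: seat_def distrib_left sum.distrib sum_distrib_right[symmetric] sum_eq_1)

text \<open>Each step adds 1 to the total, so \<open>n\<close> steps reach only states of total
  \<open>sum_list xs + n\<close>. Restricting the comparison to these is essential later, where the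
  estimates use the total.\<close>

lemma seat_pow_mono:
  assumes "\<And>ys. sum_list ys = sum_list xs + n \<Longrightarrow> g ys \<le> h ys"
  shows "(seat q ^^ n) g xs \<le> (seat q ^^ n) h xs"
  using assms
proof (induction n arbitrary: xs)
  case (Suc n)
  show ?case
    by (simp, rule seat_mono, rule Suc.IH, rule Suc.prems) (simp add: sum_list_grow)
qed simp

lemma seat_pow_const: "(seat q ^^ n) (\<lambda>_. c) xs = c"
proof (induction n arbitrary: xs)
  case (Suc n)
  then have "(seat q ^^ n) (\<lambda>_. c) = (\<lambda>_. c)" by auto
  then show ?case
    by (simp only: funpow.simps o_apply) (simp add: seat_def sum_distrib_right[symmetric] sum_eq_1)
qed simp

lemma seat_pow_abs_le:
  assumes "\<And>ys. \<bar>g ys\<bar> \<le> B"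
  shows "\<bar>(seat q ^^ n) g xs\<bar> \<le> B"
  using seat_pow_mono[of xs n g "\<lambda>_. B"] seat_pow_mono[of xs n "\<lambda>_. - B" g] assms
  by (auto simp: seat_pow_const abs_le_iff) (metis minus_le_iff)

text \<open>Drift bounds add up along the path. The horizon \<open>N\<close> is explicit because the
  function used below has the horizon as a coefficient and its drift is controlled only before that
  time.\<close>

lemma seat_pow_supermartingale_le:
  assumes "\<And>k xs. k < N \<Longrightarrow> seat q (V (Suc k)) xs \<le> V k xs + c" and "m + n \<le> N"
  shows "(seat q ^^ n) (V (m + n)) xs \<le> V m xs + real n * c"
  using assms(2)
proof (induction n arbitrary: m xs)
  case (Suc n)
  have "(seat q ^^ Suc n) (V (m + Suc n)) xs = seat q ((seat q ^^ n) (V (Suc m + n))) xs"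
    by simp
  also have "\<dots> \<le> seat q (\<lambda>xs. V (Suc m) xs + real n * c) xs"
    by (intro seat_mono Suc.IH) (use Suc.prems in simp)
  also have "\<dots> = seat q (V (Suc m)) xs + real n * c"
    by (rule seat_add_const)
  also have "\<dots> \<le> V m xs + real (Suc n) * c"
    using assms(1)[of m xs] Suc.prems by (simp add: algebra_simps)
  finally show ?case .
qed simp

end

lemma seat_sum: "seat q (\<lambda>xs. \<Sum>j\<in>J. c j * h j xs) xs = (\<Sum>j\<in>J. c j * seat q (h j) xs)"
  by (simp add: seat_def sum_distrib_left sum.swap[of _ J] mult_ac)

lemma seat_pow_sum: "(seat q ^^ n) (\<lambda>xs. \<Sum>j\<in>J. c j * h j xs) xs = (\<Sum>j\<in>J. c j * (seat q ^^ n) (h j) xs)"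
proof (induction n arbitrary: xs)
  case (Suc n)
  then have "(seat q ^^ n) (\<lambda>xs. \<Sum>j\<in>J. c j * h j xs) = (\<lambda>xs. \<Sum>j\<in>J. c j * (seat q ^^ n) (h j) xs)"
    by auto
  then show ?case
    by (simp add: seat_sum)
qed simp

lemma (in seating) seat_pow_add_const: "(seat q ^^ n) (\<lambda>xs. h xs + c) xs = (seat q ^^ n) h xs + c"
proof (induction n arbitrary: xs)
  case (Suc n)
  then have "(seat q ^^ n) (\<lambda>xs. h xs + c) = (\<lambda>xs. (seat q ^^ n) h xs + c)"
    by auto
  then show ?case
    by (simp add: seat_add_const)
qed simp

section \<open>Sampling with fixed weights\<close>

definition sampling_prob :: "(nat \<Rightarrow> real) \<Rightarrow> nat list \<Rightarrow> nat \<Rightarrow> real" where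
  "sampling_prob p xs i = (if i < length xs then p i else 1 - (\<Sum>j<length xs. p j))"

text \<open>The strict inequality keeps the chance of a new group positive in every state; the drift
  estimate divides by it.\<close>

locale species_weights =
  fixes p :: "nat \<Rightarrow> real"
  assumes p_nonneg: "0 \<le> p i" and sum_less_1: "(\<Sum>j<k. p j) < 1"
begin

sublocale seating "sampling_prob p"
proof
  fix xs
  have "(\<Sum>i\<le>length xs. sampling_prob p xs i) =
      (\<Sum>i<length xs. sampling_prob p xs i) + sampling_prob p xs (length xs)"
    by (simp add: lessThan_Suc_atMost[symmetric])
  then show "(\<Sum>i\<le>length xs. sampling_prob p xs i) = 1"
    by (simp add: sampling_prob_def)
next
  fix xs i
  show "0 \<le> sampling_prob p xs i"
    using p_nonneg sum_less_1[of "length xs"] by (simp add: sampling_prob_def)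
qed

text \<open>While group \<open>i\<close> exists, the first summand of \<open>V\<close> has drift at most 1.  Before that its drift
  is only \<open>O(N)\<close>, which the second summand pays for: a new group opens with probability at
  least \<open>r\<close> in each such step.\<close>

lemma lyapunov_drift:
  fixes i N :: nat
  defines "r \<equiv> 1 - (\<Sum>j<i. p j)"
  defines "V \<equiv> \<lambda>m xs. (pad xs i - real m * p i)\<^sup>2 + 2 * real N / r * real (Suc i - length xs)"
  assumes "m < N"
  shows "seat (sampling_prob p) (V (Suc m)) xs \<le> V m xs + 1"
proof -
  let ?q = "sampling_prob p xs" and ?k = "length xs"
  have r: "0 < r"
    using sum_less_1[of i] by (simp add: r_def)
  have p1: "p i \<le> 1"
    using sum_less_1[of "Suc i"] sum_nonneg[of "{..<i}" p] p_nonneg by simp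
  show ?thesis
  proof (cases "i < ?k")
    case True
    define d where "d = pad xs i - real m * p i"
    have "?q l * V (Suc m) (grow xs l) = ?q l * (d - p i)\<^sup>2 + (if l = i then ?q l * (2 * (d - p i) + 1) else 0)"
      if "l \<le> ?k" for l
      using that True
      by (auto simp: V_def pad_grow length_grow d_def algebra_simps power2_eq_square)
    then have "seat (sampling_prob p) (V (Suc m)) xs =
        (\<Sum>l\<le>?k. ?q l * (d - p i)\<^sup>2 + (if l = i then ?q l * (2 * (d - p i) + 1) else 0))"
      unfolding seat_def by (intro sum.cong) auto
    also have "\<dots> = (d - p i)\<^sup>2 + ?q i * (2 * (d - p i) + 1)"
      using True by (simp add: sum.distrib sum_distrib_right[symmetric] sum_eq_1)
    \<comment> \<open>The terms linear in \<open>d\<close> cancel because the centred increment has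
      mean 0; what remains is its variance \<open>p i - (p i)\<^sup>2\<close>.\<close>
    also have "\<dots> = d\<^sup>2 + p i - (p i)\<^sup>2"
      using True by (simp add: sampling_prob_def algebra_simps power2_eq_square)
    also have "\<dots> \<le> d\<^sup>2 + 1"
      using p1 by (smt (verit) zero_le_power2)
    finally show ?thesis
      using True by (simp add: V_def d_def)
  next
    case False
    have rq: "r \<le> ?q ?k"
      using False by (auto simp: r_def sampling_prob_def intro!: sum_mono2 p_nonneg)
    define c where "c = 2 * real N / r"
    have c: "0 \<le> c" "c * r = 2 * real N"
      using r by (auto simp: c_def)
    define b where "b = real m * p i"
    have b: "0 \<le> b" "b \<le> real m"
      using p_nonneg p1 by (auto simp: b_def mult_left_le)
    \<comment> \<open>The bound before any gain from an opening: in the expanded square the cross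
      term is at most \<open>2 * m\<close>, hence at most \<open>2 * N\<close>, and the last square
      is at most 1.\<close>
    define C where "C = b\<^sup>2 + 2 * real N + 1 + c * real (Suc i - ?k)"
    have "?q l * V (Suc m) (grow xs l) \<le> ?q l * C + (if l = ?k then - ?q l * c else 0)"
      if l: "l \<le> ?k" for l
    proof -
      define a where "a = (if i = l then 1 else 0 :: real)"
      have a: "a = 0 \<or> a = 1" by (auto simp: a_def)
      have "(a - (b + p i))\<^sup>2 \<le> b\<^sup>2 + 2 * real N + 1"
      proof -
        have "(a - (b + p i))\<^sup>2 = b\<^sup>2 + 2 * (b * (p i - a)) + (p i - a)\<^sup>2"
          by (simp add: power2_eq_square algebra_simps)
        moreover have "b * (p i - a) \<le> real m * 1"
        proof -
          have "b * (p i - a) \<le> b * 1"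
            using p_nonneg[of i] p1 a by (intro mult_left_mono b) auto
          then show ?thesis using b by simp
        qed
        moreover have "(p i - a)\<^sup>2 \<le> 1"
          using p_nonneg[of i] p1 a by (auto simp: abs_square_le_1)
        ultimately show ?thesis
          using \<open>m < N\<close> by simp
      qed
      moreover have "V (Suc m) (grow xs l) =
          (pad (grow xs l) i - (b + p i))\<^sup>2 + c * real (Suc i - length (grow xs l))"
        by (simp add: V_def c_def b_def distrib_right add.commute)
      moreover have "pad (grow xs l) i = a"
        unfolding pad_grow[OF l] a_def using False by (simp add: pad_def)
      \<comment> \<open>Since \<open>length xs \<le> i\<close>, the truncated difference is at least
        1 and an opening lowers it by exactly 1. With \<open>i\<close> in place of
        \<open>Suc i\<close> the opening of group \<open>i\<close> itself would earn
        nothing.\<close>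
      moreover have "real (Suc i - length (grow xs l)) = real (Suc i - ?k) - (if l = ?k then 1 else 0)"
        using False l by (auto simp: length_grow)
      ultimately have "V (Suc m) (grow xs l) \<le> C - (if l = ?k then c else 0)"
        by (simp only: C_def right_diff_distrib) (simp split: if_splits)
      then have "?q l * V (Suc m) (grow xs l) \<le> ?q l * (C - (if l = ?k then c else 0))"
        using l by (intro mult_left_mono nonneg)
      then show ?thesis
        by (auto simp: algebra_simps)
    qed
    then have "seat (sampling_prob p) (V (Suc m)) xs
        \<le> (\<Sum>l\<le>?k. ?q l * C + (if l = ?k then - ?q l * c else 0))"
      unfolding seat_def by (intro sum_mono) auto
    also have "\<dots> = C - ?q ?k * c"
      by (simp add: sum.distrib sum_distrib_right[symmetric] sum_eq_1)
    also have "\<dots> \<le> C - 2 * real N"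
      using mult_right_mono[OF rq c(1)] c(2) by (simp add: mult.commute)
    also have "\<dots> = V m xs + 1"
      using False by (simp add: V_def C_def c_def b_def pad_def)
    finally show ?thesis .
  qed
qed

text \<open>With horizon \<open>N = n\<close> the Lyapunov function starts at order \<open>n\<close>
  and gains at most 1 per step. Linear growth suffices, as frequencies divide the square by
  \<open>n\<^sup>2\<close>.\<close>

lemma second_moment_bound:
  "\<exists>C. \<forall>n. (seat (sampling_prob p) ^^ n) (\<lambda>xs. (pad xs i - real n * p i)\<^sup>2) [1] \<le> C * (real n + 1)"
proof (intro exI allI)
  fix n
  define r where "r = 1 - (\<Sum>j<i. p j)"
  have r: "0 < r"
    using sum_less_1[of i] by (simp add: r_def)
  define V where "V = (\<lambda>m xs. (pad xs i - real m * p i)\<^sup>2 + 2 * real n / r * real (Suc i - length xs))"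
  have drift: "seat (sampling_prob p) (V (Suc m)) xs \<le> V m xs + 1" if "m < n" for m xs
    unfolding V_def r_def by (rule lyapunov_drift[OF that])
  have "(seat (sampling_prob p) ^^ n) (\<lambda>xs. (pad xs i - real n * p i)\<^sup>2) [1]
      \<le> (seat (sampling_prob p) ^^ n) (V (0 + n)) [1]"
    by (rule seat_pow_mono) (use r in \<open>simp add: V_def\<close>)
  also have "\<dots> \<le> V 0 [1] + real n * 1"
    by (rule seat_pow_supermartingale_le[of n]) (auto intro!: drift)
  also have "\<dots> \<le> 1 + 2 * real n / r * real i + real n"
    by (simp add: V_def pad_def)
  also have "\<dots> \<le> (2 * real i / r + 1) * (real n + 1)"
    using r by (simp add: field_simps)
  finally show "(seat (sampling_prob p) ^^ n) (\<lambda>xs. (pad xs i - real n * p i)\<^sup>2) [1]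
      \<le> (2 * real i / (1 - (\<Sum>j<i. p j)) + 1) * (real n + 1)"
    by (simp add: r_def)
qed

text \<open>The deterministic half of uniformity: if the first \<open>J\<close> groups hold almost
  all of the weight and have nearly the right frequencies, the total leaves little room for any
  later group.\<close>

lemma pad_divide_uniformly_close:
  assumes sums: "p sums 1" and e: "0 < e"
  obtains J d where "0 < d" and "\<forall>\<^sub>F n in sequentially. \<forall>xs. sum_list xs = Suc n \<longrightarrow>
    (\<forall>i<J. \<bar>pad xs i / real n - p i\<bar> \<le> d) \<longrightarrow> (\<forall>i. \<bar>pad xs i / real n - p i\<bar> \<le> e)"
proof -
  have "(\<lambda>J. \<Sum>i<J. p i) \<longlonglongrightarrow> 1"
    using sums by (simp add: sums_def)
  then have "\<forall>\<^sub>F J in sequentially. 1 - e / 4 < (\<Sum>i<J. p i)"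
    by (rule order_tendstoD) (use e in simp)
  then obtain J where J: "1 - e / 4 < (\<Sum>i<J. p i)"
    by (auto simp: eventually_sequentially)
  \<comment> \<open>The \<open>J\<close> errors together stay below \<open>e / 4\<close>, so a later
    group has frequency at most \<open>e / 2 + 1 / n\<close>. The summand 1 covers
    \<open>J = 0\<close> and gives \<open>d \<le> e\<close>.\<close>
  define d where "d = e / (4 * (real J + 1))"
  have d: "0 < d" "real J * d \<le> e / 4" "d \<le> e"
    using e by (auto simp: d_def field_simps)
  have "(\<lambda>n. 1 / real n) \<longlonglongrightarrow> 0"
    by (rule lim_1_over_n)
  then have "\<forall>\<^sub>F n in sequentially. 1 / real n < e / 4"
    by (rule order_tendstoD) (use e in simp)
  then have "\<forall>\<^sub>F n in sequentially. \<forall>xs. sum_list xs = Suc n \<longrightarrow>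
    (\<forall>i<J. \<bar>pad xs i / real n - p i\<bar> \<le> d) \<longrightarrow> (\<forall>i. \<bar>pad xs i / real n - p i\<bar> \<le> e)"
    using eventually_gt_at_top[of 0]
  proof eventually_elim
    case (elim n)
    show ?case
    proof (intro allI impI)
      fix xs i
      assume xs: "sum_list xs = Suc n" and close: "\<forall>i<J. \<bar>pad xs i / real n - p i\<bar> \<le> d"
      show "\<bar>pad xs i / real n - p i\<bar> \<le> e"
      proof (cases "i < J")
        case True
        then show ?thesis using close d(3) by force
      next
        case False
        have "p i + (\<Sum>l<J. p l) = sum p (insert i {..<J})"
          using False by simp
        also have "\<dots> \<le> sum p {..<Suc i}"
          by (rule sum_mono2) (use False p_nonneg in auto)
        finally have pi: "p i < e / 4"
          using sum_less_1[of "Suc i"] J by linarith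
        have "(\<Sum>l<J. p l) - real J * d = (\<Sum>l<J. p l - d)"
          by (simp add: sum_subtractf)
        also have "\<dots> \<le> (\<Sum>l<J. pad xs l / real n)"
          by (rule sum_mono) (use close in \<open>force simp: abs_le_iff\<close>)
        finally have "1 - e / 4 - e / 4 \<le> (\<Sum>l<J. pad xs l / real n)"
          using J d(2) by linarith
        moreover have "(\<Sum>l\<in>insert i {..<J}. pad xs l) \<le> real (sum_list xs)"
          by (rule sum_pad_le) simp
        then have "(pad xs i + (\<Sum>l<J. pad xs l)) / real n \<le> (real n + 1) / real n"
          using False xs by (intro divide_right_mono) auto
        then have "pad xs i / real n + (\<Sum>l<J. pad xs l / real n) \<le> 1 + 1 / real n"
          using elim by (simp add: add_divide_distrib sum_divide_distrib)
        ultimately have "pad xs i / real n < e"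
          using elim e by linarith
        moreover have "0 \<le> pad xs i / real n"
          by (simp add: pad_nonneg)
        ultimately show ?thesis
          using pi p_nonneg[of i] e by linarith
      qed
    qed
  qed
  then show ?thesis
    using that d(1) by blast
qed

text \<open>Chebyshev's argument in operator form: states with good frequencies contribute an error
  below \<open>d / 2\<close>, and on the others the trivial bound \<open>2 * B\<close> is dominated
  pointwise by a multiple of squared deviations, whose expectation is of order
  \<open>1 / n\<close>.\<close>

lemma seat_pow_rearrangement_tendsto:
  fixes f :: "(nat \<Rightarrow> real) \<Rightarrow> real"
  assumes sums: "p sums 1" and y: "is_decreasing_rearrangement p y"
    and f: "continuous_on {x. \<forall>i. 0 \<le> x i} f" and B: "\<And>x. (\<And>i. 0 \<le> x i) \<Longrightarrow> \<bar>f x\<bar> \<le> B"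
  shows "(\<lambda>n. (seat (sampling_prob p) ^^ n)
    (\<lambda>xs. f (\<lambda>i. decreasing_rearrangement (pad xs) i / real n)) [1]) \<longlonglongrightarrow> f y"
proof (rule tendstoI, unfold dist_real_def)
  let ?E = "\<lambda>n h. (seat (sampling_prob p) ^^ n) h [1]"
  let ?g = "\<lambda>n xs. f (\<lambda>i. decreasing_rearrangement (pad xs) i / real n)"
  fix d :: real assume "0 < d"
  then have d: "0 < d / 2" by simp
  have y0: "0 \<le> y i" for i
    using y p_nonneg by (auto simp: is_decreasing_rearrangement_def)
  have B0: "0 \<le> B"
    using B[of y, OF y0] by linarith
  obtain e where e: "0 < e"
    "\<And>x. x \<in> {x. \<forall>i. 0 \<le> x i} \<Longrightarrow> (\<And>i. \<bar>x i - y i\<bar> \<le> e) \<Longrightarrow> \<bar>f x - f y\<bar> < d / 2"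
    using continuous_on_uniform_neighbourhood[OF f _ d, of y] y0 by auto
  obtain J t where t: "0 < t" and close: "\<forall>\<^sub>F n in sequentially. \<forall>xs. sum_list xs = Suc n \<longrightarrow>
    (\<forall>i<J. \<bar>pad xs i / real n - p i\<bar> \<le> t) \<longrightarrow> (\<forall>i. \<bar>pad xs i / real n - p i\<bar> \<le> e)"
    using pad_divide_uniformly_close[OF sums e(1)] by blast
  obtain C where C: "\<And>i n. ?E n (\<lambda>xs. (pad xs i - real n * p i)\<^sup>2) \<le> C i * (real n + 1)"
    using second_moment_bound by metis
  \<comment> \<open>Chosen so that a single frequency off by more than \<open>t\<close> already
    accounts for \<open>2 * B\<close>.\<close>
  define K where "K = 2 * B / t\<^sup>2"
  have K: "0 \<le> K" using B0 by (simp add: K_def)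
  have "(\<lambda>n. d / 2 + (K / (real n)\<^sup>2) * (\<Sum>i<J. C i * (real n + 1))) \<longlonglongrightarrow> d / 2 + 0"
  proof (intro tendsto_add tendsto_const)
    have "(\<lambda>n. 1 / real n + 1 / real n * (1 / real n)) \<longlonglongrightarrow> 0 + 0 * 0"
      by (intro tendsto_intros lim_1_over_n)
    moreover have "1 / real n + 1 / real n * (1 / real n) = (real n + 1) / (real n)\<^sup>2" for n
      by (cases "n = 0") (auto simp: field_simps power2_eq_square)
    ultimately have "(\<lambda>n. (real n + 1) / (real n)\<^sup>2) \<longlonglongrightarrow> 0"
      by simp
    from tendsto_mult[OF tendsto_const[of "K * (\<Sum>i<J. C i)"] this]
    show "(\<lambda>n. (K / (real n)\<^sup>2) * (\<Sum>i<J. C i * (real n + 1))) \<longlonglongrightarrow> 0"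
      by (simp add: sum_distrib_right[symmetric] mult_ac)
  qed
  then have "\<forall>\<^sub>F n in sequentially. d / 2 + (K / (real n)\<^sup>2) * (\<Sum>i<J. C i * (real n + 1)) < d"
    by (rule order_tendstoD) (use d in simp)
  then show "\<forall>\<^sub>F n in sequentially. \<bar>?E n (?g n) - f y\<bar> < d"
    using close eventually_gt_at_top[of 0]
  proof eventually_elim
    case (elim n)
    let ?h = "\<lambda>xs. (\<Sum>i<J. (K / (real n)\<^sup>2) * (pad xs i - real n * p i)\<^sup>2)"
    have bound: "\<bar>?g n xs - f y\<bar> \<le> ?h xs + d / 2" if xs: "sum_list xs = Suc n" for xs
    proof (cases "\<forall>i<J. \<bar>pad xs i / real n - p i\<bar> \<le> t")
      case True
      then have le: "\<bar>pad xs i / real n - p i\<bar> \<le> e" for i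
        using elim(2) xs by blast
      note dr = is_decreasing_rearrangement_pad_divide[of xs n]
      have "\<bar>decreasing_rearrangement (pad xs) i / real n - y i\<bar> \<le> e" for i
        using is_decreasing_rearrangement_le_add[OF dr y, of e i]
          is_decreasing_rearrangement_le_add[OF y dr, of e i] le
        by (force simp: abs_le_iff algebra_simps)
      then have "\<bar>?g n xs - f y\<bar> < d / 2"
        using decreasing_rearrangement_pad_divide_nonneg by (intro e(2)) auto
      moreover have "0 \<le> ?h xs"
        using K by (intro sum_nonneg) auto
      ultimately show ?thesis by linarith
    next
      case False
      then obtain i where i: "i < J" "t < \<bar>pad xs i / real n - p i\<bar>"
        by (auto simp: not_le)
      have "\<bar>?g n xs - f y\<bar> \<le> 2 * B"
        using B[of "\<lambda>i. decreasing_rearrangement (pad xs) i / real n"] B[of y, OF y0]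
          decreasing_rearrangement_pad_divide_nonneg[of xs _ n] by fastforce
      also have "\<dots> = K * t\<^sup>2"
        using t by (simp add: K_def)
      also have "\<dots> \<le> K * (pad xs i / real n - p i)\<^sup>2"
        using i(2) t by (intro mult_left_mono K) (metis abs_of_pos less_imp_le power2_le_iff_abs_le abs_le_square_iff)
      also have "\<dots> = (K / (real n)\<^sup>2) * (pad xs i - real n * p i)\<^sup>2"
        using elim(3) by (simp add: power2_eq_square field_simps)
      also have "\<dots> \<le> ?h xs"
        using i(1) K by (intro member_le_sum) auto
      finally show ?thesis using d by linarith
    qed
    have Eh: "?E n ?h \<le> (K / (real n)\<^sup>2) * (\<Sum>i<J. C i * (real n + 1))"
      unfolding seat_pow_sum sum_distrib_left
      by (intro sum_mono mult_left_mono C) (use K in auto)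
    have "?E n (?g n) \<le> ?E n (\<lambda>xs. ?h xs + (d / 2 + f y))"
      by (rule seat_pow_mono) (use bound in \<open>force simp: abs_le_iff\<close>)
    \<comment> \<open>The sign sits in the coefficients, so that linearity turns this lower bound
      into minus the expectation of \<open>?h\<close>.\<close>
    moreover have "?E n (?g n) \<ge> ?E n (\<lambda>xs. (\<Sum>i<J. (- K / (real n)\<^sup>2) * (pad xs i - real n * p i)\<^sup>2) + (f y - d / 2))"
    proof (rule seat_pow_mono)
      fix ys assume "sum_list ys = sum_list [1] + n"
      then have "\<bar>?g n ys - f y\<bar> \<le> ?h ys + d / 2"
        using bound by simp
      then show "(\<Sum>i<J. (- K / (real n)\<^sup>2) * (pad ys i - real n * p i)\<^sup>2) + (f y - d / 2) \<le> ?g n ys"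
        by (simp add: sum_negf abs_le_iff)
    qed
    moreover have "?E n (\<lambda>xs. \<Sum>i<J. (- K / (real n)\<^sup>2) * (pad xs i - real n * p i)\<^sup>2) = - ?E n ?h"
      unfolding seat_pow_sum by (simp add: sum_negf)
    ultimately show ?case
      using Eh elim(1) unfolding seat_pow_add_const by linarith
  qed
qed

end

section \<open>The restaurant process\<close>

definition crp_prob :: "real \<Rightarrow> nat list \<Rightarrow> nat \<Rightarrow> real" where
  "crp_prob \<gamma> xs i = (if i < length xs then real (xs ! i) else \<gamma>) / (real (sum_list xs) + \<gamma>)"

lemma seating_crp_prob:
  assumes "\<gamma> > 0"
  shows "seating (crp_prob \<gamma>)"
proof
  fix xs :: "nat list"
  have "(\<Sum>i\<le>length xs. crp_prob \<gamma> xs i) = (\<Sum>i<length xs. crp_prob \<gamma> xs i) + crp_prob \<gamma> xs (length xs)"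
    by (simp add: lessThan_Suc_atMost[symmetric])
  also have "\<dots> = (real (sum_list xs) + \<gamma>) / (real (sum_list xs) + \<gamma>)"
    by (simp add: crp_prob_def sum_divide_distrib[symmetric] add_divide_distrib[symmetric] sum_list_sum_nth atLeast0LessThan)
  also have "\<dots> = 1"
    using assms by (intro divide_self) linarith
  finally show "(\<Sum>i\<le>length xs. crp_prob \<gamma> xs i) = 1" .
qed (use assms in \<open>simp add: crp_prob_def\<close>)

lemma crp_transition_altdef:
  "crp_transition \<gamma> xs ys = (\<Sum>i\<le>length xs. if ys = grow xs i then crp_prob \<gamma> xs i else 0)"
  unfolding crp_transition_def lessThan_Suc_atMost[symmetric] sum.lessThan_Suc
  by (intro arg_cong2[where f = "(+)"] sum.cong) (auto simp: grow_def crp_prob_def)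

text \<open>Passage from probabilities indexed by states to the operator indexed by seats: after
  swapping the sums, each seat selects the one state it leads to.\<close>

lemma sum_crp_transition:
  "(\<Sum>ys\<in>grow xs ` {..length xs}. crp_transition \<gamma> xs ys * h ys) = seat (crp_prob \<gamma>) h xs"
proof -
  let ?S = "grow xs ` {..length xs}"
  have "(\<Sum>ys\<in>?S. crp_transition \<gamma> xs ys * h ys) =
      (\<Sum>ys\<in>?S. \<Sum>i\<le>length xs. if ys = grow xs i then crp_prob \<gamma> xs i * h ys else 0)"
    unfolding crp_transition_altdef by (auto simp: sum_distrib_right intro!: sum.cong)
  also have "\<dots> = (\<Sum>i\<le>length xs. \<Sum>ys\<in>?S. if ys = grow xs i then crp_prob \<gamma> xs i * h ys else 0)"
    by (rule sum.swap)
  also have "\<dots> = seat (crp_prob \<gamma>) h xs"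
    unfolding seat_def by (intro sum.cong refl) (subst sum.delta, auto)
  finally show ?thesis .
qed

text \<open>The Markov property without conditional expectations. Only path probabilities are given,
  so the integral is localised to a path; the induction on the remaining steps extends that path by
  one state and needs it arbitrary.\<close>

lemma crp_chain_integral_path:
  assumes \<gamma>: "\<gamma> > 0" and chain: "crp_chain M \<gamma> X" and B: "\<And>xs. \<bar>g xs\<bar> \<le> B"
  shows "(LINT \<omega>|M. indicator {\<omega> \<in> space M. \<forall>k\<le>n. X k \<omega> = s k} \<omega> * g (X (n + m) \<omega>)) =
    measure M {\<omega> \<in> space M. \<forall>k\<le>n. X k \<omega> = s k} * (seat (crp_prob \<gamma>) ^^ m) g (s n)"
proof (induction m arbitrary: n s)
  case 0
  interpret prob_space M using chain by (simp add: crp_chain_def markov_chain_def)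
  have [measurable]: "X k \<in> M \<rightarrow>\<^sub>M count_space UNIV" for k
    using chain by (simp add: crp_chain_def markov_chain_def)
  have "(LINT \<omega>|M. indicator {\<omega> \<in> space M. \<forall>k\<le>n. X k \<omega> = s k} \<omega> * g (X (n + 0) \<omega>)) =
     (LINT \<omega>|M. indicator {\<omega> \<in> space M. \<forall>k\<le>n. X k \<omega> = s k} \<omega> * g (s n))"
    by (intro Bochner_Integration.integral_cong refl) (auto simp: indicator_def)
  then show ?case by simp
next
  case (Suc m)
  interpret prob_space M using chain by (simp add: crp_chain_def markov_chain_def)
  interpret seating "crp_prob \<gamma>" by (rule seating_crp_prob[OF \<gamma>])
  have [measurable]: "X k \<in> M \<rightarrow>\<^sub>M count_space UNIV" for k
    using chain by (simp add: crp_chain_def markov_chain_def)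
  define A where "A = {\<omega> \<in> space M. \<forall>k\<le>n. X k \<omega> = s k}"
  define A' where "A' y = {\<omega> \<in> space M. \<forall>k\<le>Suc n. X k \<omega> = (s(Suc n := y)) k}" for y
  have [measurable]: "A \<in> sets M" "A' y \<in> sets M" for y
    unfolding A_def A'_def by measurable
  have A'_eq: "A' y = {\<omega> \<in> A. X (Suc n) \<omega> = y}" for y
    by (auto simp: A_def A'_def le_Suc_eq)
  have prob_A': "prob (A' y) = prob A * crp_transition \<gamma> (s n) y" for y
  proof -
    have "prob (A' y) = prob {\<omega> \<in> space M. \<forall>k\<le>n. X k \<omega> = (s(Suc n := y)) k} * crp_transition \<gamma> (s n) y"
    proof -
      have "prob {\<omega> \<in> space M. \<forall>k\<le>Suc n. X k \<omega> = u k} =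
          prob {\<omega> \<in> space M. \<forall>k\<le>n. X k \<omega> = u k} * crp_transition \<gamma> (u n) (u (Suc n))" for u
        using chain unfolding crp_chain_def markov_chain_def by blast
      from this[of "s(Suc n := y)"] show ?thesis
        by (simp add: A'_def)
    qed
    also have "{\<omega> \<in> space M. \<forall>k\<le>n. X k \<omega> = (s(Suc n := y)) k} = A"
      by (auto simp: A_def)
    finally show ?thesis .
  qed
  \<comment> \<open>The transition probabilities out of \<open>s n\<close> already sum to 1 over
    this finite set, so other values of the next state form a null set and a finite sum replaces one
    over all states.\<close>
  define S where "S = grow (s n) ` {..length (s n)}"
  have S: "finite S" by (simp add: S_def)
  have disj: "disjoint_family_on A' S"
    by (auto simp: disjoint_family_on_def A'_eq)
  have "prob (\<Union>y\<in>S. A' y) = (\<Sum>y\<in>S. prob A * crp_transition \<gamma> (s n) y)"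
    by (subst finite_measure_finite_Union[OF S _ disj]) (auto simp: prob_A')
  also have "\<dots> = prob A * (\<Sum>y\<in>S. crp_transition \<gamma> (s n) y * 1)"
    by (simp add: sum_distrib_left)
  also have "\<dots> = prob A"
    unfolding S_def sum_crp_transition by (simp add: seat_def sum_eq_1)
  finally have "prob (A - (\<Union>y\<in>S. A' y)) = 0"
    by (subst finite_measure_Diff) (auto simp: A'_eq intro!: sets.countable_UN'' countable_finite S)
  then have null: "A - (\<Union>y\<in>S. A' y) \<in> null_sets M"
    using S by (intro null_setsI) (auto simp: emeasure_eq_measure)
  have "(LINT \<omega>|M. indicator A \<omega> * g (X (n + Suc m) \<omega>)) =
      (LINT \<omega>|M. (\<Sum>y\<in>S. indicator (A' y) \<omega> * g (X (Suc n + m) \<omega>)))"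
  proof (rule integral_cong_AE)
    show "AE \<omega> in M. indicator A \<omega> * g (X (n + Suc m) \<omega>) =
        (\<Sum>y\<in>S. indicator (A' y) \<omega> * g (X (Suc n + m) \<omega>))"
    proof (rule AE_I'[OF null], rule subsetI, rule ccontr)
      fix \<omega>
      assume bad: "\<omega> \<in> {\<omega> \<in> space M. indicator A \<omega> * g (X (n + Suc m) \<omega>) \<noteq>
        (\<Sum>y\<in>S. indicator (A' y) \<omega> * g (X (Suc n + m) \<omega>))}" and "\<omega> \<notin> A - (\<Union>y\<in>S. A' y)"
      then have "\<omega> \<in> A \<longleftrightarrow> X (Suc n) \<omega> \<in> S \<and> \<omega> \<in> A"
        by (auto simp: A'_eq)
      then have "indicator A \<omega> = (\<Sum>y\<in>S. if X (Suc n) \<omega> = y then indicator A \<omega> else 0 :: real)"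
        using S by (auto simp: indicator_def)
      also have "\<dots> = (\<Sum>y\<in>S. indicator (A' y) \<omega>)"
        by (intro sum.cong) (auto simp: A'_eq indicator_def)
      finally show False
        using bad by (simp add: sum_distrib_right)
    qed
  qed measurable
  also have "\<dots> = (\<Sum>y\<in>S. LINT \<omega>|M. indicator (A' y) \<omega> * g (X (Suc n + m) \<omega>))"
  proof (rule Bochner_Integration.integral_sum)
    fix y
    show "integrable M (\<lambda>\<omega>. indicator (A' y) \<omega> * g (X (Suc n + m) \<omega>))"
    proof (rule integrable_const_bound[where B = B])
      have "0 \<le> B" using B[of "[]"] by linarith
      then show "AE \<omega> in M. norm (indicator (A' y) \<omega> * g (X (Suc n + m) \<omega>)) \<le> B"
        using B by (auto simp: indicator_def)
    qed measurable
  qed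
  also have "\<dots> = (\<Sum>y\<in>S. prob (A' y) * (seat (crp_prob \<gamma>) ^^ m) g y)"
    unfolding A'_def Suc.IH by simp
  also have "\<dots> = prob A * (\<Sum>y\<in>S. crp_transition \<gamma> (s n) y * (seat (crp_prob \<gamma>) ^^ m) g y)"
    by (simp add: prob_A' sum_distrib_left mult.assoc)
  also have "\<dots> = prob A * (seat (crp_prob \<gamma>) ^^ Suc m) g (s n)"
    unfolding S_def sum_crp_transition by simp
  finally show ?case
    by (simp add: A_def)
qed

lemma crp_chain_integral:
  assumes \<gamma>: "\<gamma> > 0" and chain: "crp_chain M \<gamma> X" and B: "\<And>xs. \<bar>g xs\<bar> \<le> B"
  shows "(LINT \<omega>|M. g (X n \<omega>)) = (seat (crp_prob \<gamma>) ^^ n) g [1]"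
proof -
  interpret prob_space M using chain by (simp add: crp_chain_def markov_chain_def)
  have [measurable]: "X k \<in> M \<rightarrow>\<^sub>M count_space UNIV" for k
    using chain by (simp add: crp_chain_def markov_chain_def)
  have X0: "AE \<omega> in M. X 0 \<omega> = [1]"
    using chain by (simp add: crp_chain_def markov_chain_def)
  let ?A = "{\<omega> \<in> space M. \<forall>k\<le>0. X k \<omega> = (\<lambda>_. [1]) k}"
  have "(LINT \<omega>|M. g (X n \<omega>)) = (LINT \<omega>|M. indicator ?A \<omega> * g (X (0 + n) \<omega>))"
    by (rule integral_cong_AE) (use X0 in \<open>auto simp: indicator_def\<close>)
  also have "\<dots> = prob ?A * (seat (crp_prob \<gamma>) ^^ n) g [1]"
    by (rule crp_chain_integral_path[OF \<gamma> chain B])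
  also have "prob ?A = 1"
    using X0 by (subst prob_eq_1) auto
  finally show ?thesis by simp
qed

section \<open>Beta integrals\<close>

text \<open>A monomial only shifts the exponents of the density, so the integral is a quotient of
  normalising constants.\<close>

lemma
  fixes a b :: real
  assumes "a > 0" "b > 0"
  shows integrable_beta_distribution_monomial:
      "integrable (beta_distribution a b) (\<lambda>x. x ^ k * (1 - x) ^ l)" (is ?integrable)
    and integral_beta_distribution_monomial:
      "(LINT x|beta_distribution a b. x ^ k * (1 - x) ^ l) = Beta (a + real k) (b + real l) / Beta a b"
      (is ?integral)
proof -
  define g where "g x = indicator {0<..<1} x * (x powr (a - 1) * (1 - x) powr (b - 1) / Beta a b)"
    for x :: real
  define h where "h x = x powr (a + real k - 1) * (1 - x) powr (b + real l - 1)" for x :: real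
  have Beta_pos: "0 < Beta a b"
    using assms by (simp add: Beta_def)
  have [measurable]: "g \<in> borel_measurable borel"
    unfolding g_def by measurable
  have g0: "AE x in lborel. 0 \<le> g x"
    using Beta_pos by (simp add: g_def)
  have beta_eq: "beta_distribution a b = density lborel (\<lambda>x. ennreal (g x))"
    by (simp add: beta_distribution_def g_def)
  \<comment> \<open>The density lives on the open interval and the Beta integral on the closed one;
    the endpoints are null.\<close>
  have "AE x in lborel. x \<noteq> (0 :: real) \<and> x \<noteq> 1"
    using AE_lborel_singleton[of 0] AE_lborel_singleton[of 1] by eventually_elim auto
  then have AE_eq: "AE x in lborel. g x * (x ^ k * (1 - x) ^ l) = indicator {0..1} x *\<^sub>R h x / Beta a b"
  proof eventually_elim
    case (elim x)
    show ?case
    proof (cases "0 < x \<and> x < 1")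
      case True
      then have "h x = (x powr (a - 1) * x ^ k) * ((1 - x) powr (b - 1) * (1 - x) ^ l)"
        by (simp add: h_def powr_add[symmetric] powr_realpow[symmetric] algebra_simps)
      then show ?thesis
        using True by (simp add: g_def)
    qed (use elim in \<open>auto simp: g_def\<close>)
  qed
  have h_int: "integrable lborel (\<lambda>x. indicator {0..1} x *\<^sub>R h x)"
    using integrable_Beta[of "a + real k" "b + real l"] assms
    by (simp add: set_integrable_def h_def)
  have "integrable lborel (\<lambda>x. g x * (x ^ k * (1 - x) ^ l))"
    by (subst integrable_cong_AE[OF _ _ AE_eq]) (use h_int in \<open>auto simp: h_def\<close>)
  then show ?integrable
    unfolding beta_eq by (subst integrable_real_density) (use g0 in auto)
  have "(LINT x|beta_distribution a b. x ^ k * (1 - x) ^ l) = (LINT x|lborel. g x * (x ^ k * (1 - x) ^ l))"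
    unfolding beta_eq by (subst integral_real_density) (use g0 in auto)
  also have "\<dots> = (LINT x|lborel. indicator {0..1} x *\<^sub>R h x / Beta a b)"
    by (rule integral_cong_AE[OF _ _ AE_eq]) (auto simp: h_def)
  also have "\<dots> = (LINT x:{0..1}|lborel. h x) / Beta a b"
    by (simp add: set_lebesgue_integral_def)
  also have "(LINT x:{0..1}|lborel. h x) = integral {0..1} h"
    by (rule set_borel_integral_eq_integral) (use h_int in \<open>simp add: set_integrable_def\<close>)
  also have "\<dots> = Beta (a + real k) (b + real l)"
    unfolding h_def by (rule integral_unique, rule has_integral_Beta_real) (use assms in auto)
  finally show ?integral .
qed

lemma sets_beta_distribution [simp, measurable_cong]: "sets (beta_distribution a b) = sets borel"
  by (simp add: beta_distribution_def)

lemma space_beta_distribution [simp]: "space (beta_distribution a b) = UNIV"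
  by (simp add: beta_distribution_def)

lemma prob_space_beta_distribution:
  assumes "a > 0" "b > 0"
  shows "prob_space (beta_distribution a b)"
proof
  have "0 < Beta a b"
    using assms by (simp add: Beta_def)
  then have "measure (beta_distribution a b) UNIV = 1"
    using integral_beta_distribution_monomial[OF assms, of 0 0] by simp
  moreover have "emeasure (beta_distribution a b) UNIV < \<infinity>"
    using integrable_beta_distribution_monomial[OF assms, of 0 0]
    by (simp add: integrable_iff_bounded)
  ultimately show "emeasure (beta_distribution a b) (space (beta_distribution a b)) = 1"
    by (simp add: emeasure_eq_ennreal_measure)
qed

lemma AE_beta_distribution: "AE x in beta_distribution a b. 0 < x \<and> x < 1"
  unfolding beta_distribution_def by (subst AE_density) (auto simp: indicator_def)

text \<open>The integrand sees finitely many coordinates, so it can be integrated over a finite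
  product, where independence factorises it.\<close>

lemma (in product_prob_space) integral_PiM_prod:
  fixes f :: "'i \<Rightarrow> 'a \<Rightarrow> real"
  assumes J: "finite J" "J \<subseteq> I" and int: "\<And>i. i \<in> J \<Longrightarrow> integrable (M i) (f i)"
  shows "(LINT x|PiM I M. (\<Prod>i\<in>J. f i (x i))) = (\<Prod>i\<in>J. integral\<^sup>L (M i) (f i))"
proof -
  interpret J: finite_product_prob_space M J
    by standard (rule J)
  have "(\<lambda>x. \<Prod>i\<in>J. f i (x i)) \<in> borel_measurable (PiM J M)"
    by (intro borel_measurable_prod measurable_compose[OF measurable_component_singleton]
        borel_measurable_integrable int) auto
  then have "(LINT x|PiM J M. (\<Prod>i\<in>J. f i (x i))) = (LINT x|PiM I M. (\<Prod>i\<in>J. f i (restrict x J i)))"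
    by (subst distr_PiM_restrict_finite[OF J, symmetric])
      (rule integral_distr[OF measurable_restrict_subset[OF J(2)]])
  also have "\<dots> = (LINT x|PiM I M. (\<Prod>i\<in>J. f i (x i)))"
    by simp
  finally show ?thesis
    using product_integral_prod[OF J(1) int] by simp
qed

section \<open>The mixture representation\<close>

lemma sum_stick_breaking: "(\<Sum>i<k. stick_breaking u i) = 1 - (\<Prod>i<k. 1 - u i)"
  by (induction k) (auto simp: stick_breaking_def algebra_simps)

lemma species_weights_stick_breaking:
  assumes "\<And>i. 0 < u i" "\<And>i. u i < 1"
  shows "species_weights (stick_breaking u)"
proof
  have "0 < (\<Prod>i<k. 1 - u i)" for k
    using assms by (intro prod_pos) auto
  then show "0 \<le> stick_breaking u k" "(\<Sum>i<k. stick_breaking u i) < 1" for k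
    using assms(1)[of k] by (simp_all add: sum_stick_breaking) (simp add: stick_breaking_def less_imp_le)
qed

text \<open>The probability, given the sticks \<open>u\<close>, of any single path of the chain that ends in \<open>xs\<close>;
  \<open>crp_weight\<close> below is its counterpart for the restaurant process.\<close>

definition stick_weight :: "(nat \<Rightarrow> real) \<Rightarrow> nat list \<Rightarrow> real" where
  "stick_weight u xs = (\<Prod>i<length xs. stick_breaking u i ^ (xs ! i - 1) * (\<Prod>j<i. 1 - u j))"

text \<open>Joining group \<open>i\<close> adds one power of its stick length; opening a group adds
  the remaining stick. Positive entries make the truncated \<open>xs ! i - 1\<close> a true
  predecessor.\<close>

lemma stick_weight_grow:
  assumes "\<forall>x\<in>set xs. 0 < x" "i \<le> length xs"
  shows "stick_weight u (grow xs i) = stick_weight u xs * sampling_prob (stick_breaking u) xs i"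
proof (cases "i < length xs")
  case True
  let ?p = "stick_breaking u" and ?R = "\<lambda>i. \<Prod>j<i. 1 - u j"
  have xi: "0 < xs ! i"
    using True assms(1) by simp
  have "stick_weight u (grow xs i) = ?p i ^ (xs ! i) * ?R i *
      (\<Prod>l\<in>{..<length xs} - {i}. ?p l ^ (xs ! l - 1) * ?R l)"
    using True by (simp add: stick_weight_def grow_def prod.remove[of _ i] cong: prod.cong_simp)
  also have "?p i ^ (xs ! i) = ?p i * ?p i ^ (xs ! i - 1)"
    using xi by (metis power_minus_mult mult.commute)
  finally show ?thesis
    using True by (simp add: stick_weight_def sampling_prob_def prod.remove[of _ i])
next
  case False
  then show ?thesis
    using assms(2)
    by (simp add: stick_weight_def grow_def sampling_prob_def sum_stick_breaking nth_append)
qed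

text \<open>Regrouping by stick: every member of a later group, its founder included, contributes
  one factor \<open>1 - u i\<close>. The factors for different \<open>i\<close> are then
  independent.\<close>

lemma stick_weight_altdef:
  assumes "\<forall>x\<in>set xs. 0 < x"
  shows "stick_weight u xs =
    (\<Prod>i<length xs. u i ^ (xs ! i - 1) * (1 - u i) ^ sum_list (drop (Suc i) xs))"
  using assms
proof (induction xs rule: rev_induct)
  case (snoc x xs)
  let ?k = "length xs" and ?R = "\<Prod>j<length xs. 1 - u j"
  have "stick_weight u (xs @ [x]) = stick_weight u xs * ((u ?k * ?R) ^ (x - 1) * ?R)"
    by (simp add: stick_weight_def nth_append stick_breaking_def)
  also have "(u ?k * ?R) ^ (x - 1) * ?R = u ?k ^ (x - 1) * ?R ^ x"
    using snoc.prems power_minus_mult[of x ?R] by (simp add: power_mult_distrib mult.assoc)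
  also have "stick_weight u xs * (u ?k ^ (x - 1) * ?R ^ x) =
      (\<Prod>i<?k. u i ^ (xs ! i - 1) * (1 - u i) ^ sum_list (drop (Suc i) xs) * (1 - u i) ^ x) * u ?k ^ (x - 1)"
    using snoc by (simp add: prod.distrib prod_power_distrib)
  also have "\<dots> = (\<Prod>i<length (xs @ [x]). u i ^ ((xs @ [x]) ! i - 1) * (1 - u i) ^ sum_list (drop (Suc i) (xs @ [x])))"
    by (simp add: nth_append power_add mult.assoc)
  finally show ?case .
qed (simp add: stick_weight_def)

lemma stick_weight_bounds:
  assumes "\<And>i. 0 < u i" "\<And>i. u i < 1" "\<forall>x\<in>set xs. 0 < x"
  shows "0 \<le> stick_weight u xs" "stick_weight u xs \<le> 1"
proof -
  have "0 \<le> u i ^ k * (1 - u i) ^ l" "u i ^ k * (1 - u i) ^ l \<le> 1" for i k l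
    using assms(1,2)[of i] by (auto intro!: mult_le_one power_le_one simp: less_imp_le)
  then show "0 \<le> stick_weight u xs" "stick_weight u xs \<le> 1"
    unfolding stick_weight_altdef[OF assms(3)] by (auto intro!: prod_nonneg prod_le_1)
qed

section \<open>Path weights of the restaurant process\<close>

lemma Gamma_plus1_pos: "0 < x \<Longrightarrow> Gamma (x + 1) = x * Gamma x" for x :: real
  by (rule Gamma_plus1) auto

text \<open>Ewens' formula, with factorials and the rising factorial of \<gamma> written as Gamma
  values so that the functional equation yields the ratio of consecutive states.\<close>

definition crp_weight :: "real \<Rightarrow> nat list \<Rightarrow> real" where
  "crp_weight \<gamma> xs = \<gamma> ^ length xs * (\<Prod>i<length xs. Gamma (real (xs ! i))) *
     Gamma \<gamma> / Gamma (real (sum_list xs) + \<gamma>)"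

lemma crp_weight_grow:
  assumes \<gamma>: "\<gamma> > 0" and xs: "\<forall>x\<in>set xs. 0 < x" and i: "i \<le> length xs"
  shows "crp_weight \<gamma> (grow xs i) = crp_weight \<gamma> xs * crp_prob \<gamma> xs i"
proof -
  have m: "0 < real (sum_list xs) + \<gamma>"
    using \<gamma> by linarith
  have "real (sum_list (grow xs i)) + \<gamma> = (real (sum_list xs) + \<gamma>) + 1"
    by (simp add: sum_list_grow)
  also have "Gamma \<dots> = (real (sum_list xs) + \<gamma>) * Gamma (real (sum_list xs) + \<gamma>)"
    by (rule Gamma_plus1_pos) (rule m)
  finally have G: "Gamma (real (sum_list (grow xs i)) + \<gamma>) =
    (real (sum_list xs) + \<gamma>) * Gamma (real (sum_list xs) + \<gamma>)" .
  show ?thesis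
  proof (cases "i < length xs")
    case True
    have xi: "0 < real (xs ! i)"
      using True xs by simp
    have "(\<Prod>l<length (grow xs i). Gamma (real (grow xs i ! l))) =
        Gamma (real (xs ! i) + 1) * (\<Prod>l\<in>{..<length xs} - {i}. Gamma (real (xs ! l)))"
      using True by (simp add: grow_def prod.remove[of _ i] add.commute cong: prod.cong_simp)
    also have "Gamma (real (xs ! i) + 1) = real (xs ! i) * Gamma (real (xs ! i))"
      by (rule Gamma_plus1_pos) (rule xi)
    finally have P: "(\<Prod>l<length (grow xs i). Gamma (real (grow xs i ! l))) =
        real (xs ! i) * (\<Prod>l<length xs. Gamma (real (xs ! l)))"
      using True by (simp add: prod.remove[of _ i])
    show ?thesis
      using True unfolding crp_weight_def P G by (simp add: crp_prob_def length_grow mult_ac)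
  next
    case False
    then show ?thesis
      using i unfolding crp_weight_def G
      by (simp add: grow_def crp_prob_def nth_append mult_ac)
  qed
qed

text \<open>With \<open>s\<close> the total after entry \<open>x\<close>, the Beta value is
  \<open>Gamma x * Gamma (s + \<gamma>) / Gamma (x + s + \<gamma>)\<close>, so the tail totals
  telescope, and each \<open>1 / Beta 1 \<gamma>\<close> gives a factor \<gamma>.\<close>

lemma prod_Beta_eq_crp_weight:
  assumes "\<gamma> > 0" "\<forall>x\<in>set xs. 0 < x"
  shows "(\<Prod>i<length xs. Beta (real (xs ! i)) (real (sum_list (drop (Suc i) xs)) + \<gamma>) / Beta 1 \<gamma>)
    = crp_weight \<gamma> xs"
  using assms(2)
proof (induction xs)
  case Nil
  have "Gamma \<gamma> \<noteq> 0" using Gamma_real_pos[OF assms(1)] by linarith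
  then show ?case by (simp add: crp_weight_def)
next
  case (Cons x xs)
  have "0 < real (sum_list xs) + \<gamma>"
    using assms(1) by linarith
  then have pos: "Gamma \<gamma> \<noteq> 0" "Gamma (real (sum_list xs) + \<gamma>) \<noteq> 0"
    using Gamma_real_pos assms(1) by (metis less_irrefl)+
  have "Beta 1 \<gamma> = 1 / \<gamma>"
    using Gamma_plus1_pos[OF assms(1)] assms(1) pos by (simp add: Beta_def add.commute)
  then have "(\<Prod>i<length (x # xs). Beta (real ((x # xs) ! i)) (real (sum_list (drop (Suc i) (x # xs))) + \<gamma>) / Beta 1 \<gamma>)
     = \<gamma> * Beta (real x) (real (sum_list xs) + \<gamma>) * crp_weight \<gamma> xs"
    using Cons by (simp add: prod.lessThan_Suc_shift del: prod.lessThan_Suc)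
  also have "\<dots> = crp_weight \<gamma> (x # xs)"
    using pos by (simp add: crp_weight_def Beta_def prod.lessThan_Suc_shift add.assoc del: prod.lessThan_Suc)
  finally show ?case .
qed

lemma measurable_stick_breaking:
  assumes [measurable]: "\<And>i. (\<lambda>u. u i) \<in> borel_measurable N"
  shows "(\<lambda>u. stick_breaking u i) \<in> borel_measurable N"
  unfolding stick_breaking_def by (intro borel_measurable_times borel_measurable_prod borel_measurable_diff assms) simp

lemma measurable_seat_pow_sampling_prob:
  assumes "\<And>i. (\<lambda>u. p u i) \<in> borel_measurable N"
  shows "(\<lambda>u. (seat (sampling_prob (p u)) ^^ n) g xs) \<in> borel_measurable N"
proof (induction n arbitrary: xs)
  case (Suc n)
  have "(\<lambda>u. sampling_prob (p u) xs i) \<in> borel_measurable N" for i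
    by (cases "i < length xs") (auto simp: sampling_prob_def intro!: assms borel_measurable_sum borel_measurable_diff)
  then show ?case
    unfolding funpow.simps o_apply by (subst seat_def) (intro borel_measurable_sum borel_measurable_times Suc.IH)
qed simp

lemma measurable_stick_weight:
  assumes "\<And>i. (\<lambda>u. u i) \<in> borel_measurable N"
  shows "(\<lambda>u. stick_weight u xs) \<in> borel_measurable N"
  unfolding stick_weight_def
  by (intro borel_measurable_times borel_measurable_power borel_measurable_prod borel_measurable_diff
      measurable_stick_breaking assms) simp

section \<open>Averages over independent Beta sticks\<close>

context
  fixes \<gamma> :: real and P :: "(nat \<Rightarrow> real) measure"
  assumes \<gamma>: "\<gamma> > 0"
  defines "P \<equiv> Pi\<^sub>M UNIV (\<lambda>_. beta_distribution 1 \<gamma>)"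
begin

lemma product_prob_space_sticks: "product_prob_space (\<lambda>_ :: nat. beta_distribution 1 \<gamma>)"
  by (simp add: product_prob_spaceI prob_space_beta_distribution \<gamma>)

interpretation P: prob_space P
  unfolding P_def by (intro prob_space_PiM prob_space_beta_distribution \<gamma>) simp

lemma measurable_sticks_component: "(\<lambda>u. u i) \<in> borel_measurable P"
proof -
  have "(\<lambda>u. u i) \<in> P \<rightarrow>\<^sub>M beta_distribution 1 \<gamma>"
    unfolding P_def by measurable
  then show ?thesis by (simp cong: measurable_cong_sets)
qed

lemma AE_sticks: "AE u in P. \<forall>i. 0 < u i \<and> u i < 1"
  unfolding AE_all_countable P_def
  by (intro allI AE_PiM_component prob_space_beta_distribution AE_beta_distribution \<gamma>) auto

lemma integral_stick_weight:
  assumes "\<forall>x\<in>set xs. 0 < x"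
  shows "(LINT u|P. stick_weight u xs) = crp_weight \<gamma> xs"
proof -
  have "(LINT u|P. stick_weight u xs) =
      (\<Prod>i<length xs. LINT x|beta_distribution 1 \<gamma>. x ^ (xs ! i - 1) * (1 - x) ^ sum_list (drop (Suc i) xs))"
    unfolding stick_weight_altdef[OF assms] P_def
    by (rule product_prob_space.integral_PiM_prod[OF product_prob_space_sticks]) (use \<gamma> in \<open>auto intro!: integrable_beta_distribution_monomial\<close>)
  also have "\<dots> = (\<Prod>i<length xs. Beta (real (xs ! i)) (real (sum_list (drop (Suc i) xs)) + \<gamma>) / Beta 1 \<gamma>)"
  proof (rule prod.cong[OF refl])
    fix i assume "i \<in> {..<length xs}"
    then have "0 < xs ! i"
      using assms by simp
    then have "1 + real (xs ! i - 1) = real (xs ! i)"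
      by linarith
    then show "(LINT x|beta_distribution 1 \<gamma>. x ^ (xs ! i - 1) * (1 - x) ^ sum_list (drop (Suc i) xs)) =
        Beta (real (xs ! i)) (real (sum_list (drop (Suc i) xs)) + \<gamma>) / Beta 1 \<gamma>"
      by (subst integral_beta_distribution_monomial) (use \<gamma> in \<open>auto simp: add.commute\<close>)
  qed
  also have "\<dots> = crp_weight \<gamma> xs"
    by (rule prod_Beta_eq_crp_weight[OF \<gamma> assms])
  finally show ?thesis .
qed

text \<open>Weighting by the path probability up to \<open>xs\<close> makes the induction close: on
  both sides the weight absorbs the next transition probability and becomes the weight of the
  successor. At \<open>[1]\<close> both weights are 1.\<close>

lemma integral_stick_weight_seat_pow:
  assumes B: "\<And>xs. \<bar>g xs\<bar> \<le> B" and "\<forall>x\<in>set xs. 0 < x"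
  shows "(LINT u|P. stick_weight u xs * (seat (sampling_prob (stick_breaking u)) ^^ n) g xs) =
    crp_weight \<gamma> xs * (seat (crp_prob \<gamma>) ^^ n) g xs"
  using assms(2)
proof (induction n arbitrary: xs)
  case 0
  then show ?case
    by (simp add: integral_stick_weight)
next
  case (Suc n)
  let ?F = "\<lambda>u. (seat (sampling_prob (stick_breaking u)) ^^ n) g"
  have pos: "\<forall>x\<in>set (grow xs i). 0 < x" for i
    using Suc.prems set_update_subset_insert[of xs i] by (auto simp: grow_def)
  have int: "integrable P (\<lambda>u. stick_weight u (grow xs i) * ?F u (grow xs i))" for i
  proof (rule P.integrable_const_bound[where B = B])
    \<comment> \<open>Only almost sure: for sticks outside the unit interval
      \<open>sampling_prob\<close> can be negative.\<close>
    show "AE u in P. norm (stick_weight u (grow xs i) * ?F u (grow xs i)) \<le> B"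
      using AE_sticks
    proof eventually_elim
      case (elim u)
      interpret species_weights "stick_breaking u"
        by (rule species_weights_stick_breaking) (use elim in auto)
      have "\<bar>stick_weight u (grow xs i)\<bar> \<le> 1"
        using stick_weight_bounds[of u "grow xs i"] elim pos by auto
      moreover have "\<bar>?F u (grow xs i)\<bar> \<le> B"
        by (rule seat_pow_abs_le) (rule B)
      ultimately have "\<bar>stick_weight u (grow xs i)\<bar> * \<bar>?F u (grow xs i)\<bar> \<le> 1 * B"
        by (intro mult_mono) auto
      then show ?case by (simp add: abs_mult)
    qed
  qed (intro borel_measurable_times measurable_stick_weight measurable_seat_pow_sampling_prob
      measurable_stick_breaking measurable_sticks_component)
  have "(LINT u|P. stick_weight u xs * (seat (sampling_prob (stick_breaking u)) ^^ Suc n) g xs) =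
      (LINT u|P. (\<Sum>i\<le>length xs. stick_weight u (grow xs i) * ?F u (grow xs i)))"
  proof (intro Bochner_Integration.integral_cong refl)
    fix u
    have "stick_weight u xs * (seat (sampling_prob (stick_breaking u)) ^^ Suc n) g xs =
        (\<Sum>i\<le>length xs. stick_weight u xs * (sampling_prob (stick_breaking u) xs i * ?F u (grow xs i)))"
      unfolding funpow.simps o_apply by (subst seat_def) (rule sum_distrib_left)
    also have "\<dots> = (\<Sum>i\<le>length xs. stick_weight u (grow xs i) * ?F u (grow xs i))"
      by (intro sum.cong refl) (simp add: stick_weight_grow[OF Suc.prems])
    finally show "stick_weight u xs * (seat (sampling_prob (stick_breaking u)) ^^ Suc n) g xs =
        (\<Sum>i\<le>length xs. stick_weight u (grow xs i) * ?F u (grow xs i))" .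
  qed
  also have "\<dots> = (\<Sum>i\<le>length xs. LINT u|P. stick_weight u (grow xs i) * ?F u (grow xs i))"
    by (rule Bochner_Integration.integral_sum) (rule int)
  also have "\<dots> = (\<Sum>i\<le>length xs. crp_weight \<gamma> (grow xs i) * (seat (crp_prob \<gamma>) ^^ n) g (grow xs i))"
    by (intro sum.cong refl Suc.IH pos)
  also have "\<dots> = (\<Sum>i\<le>length xs. crp_weight \<gamma> xs * (crp_prob \<gamma> xs i * (seat (crp_prob \<gamma>) ^^ n) g (grow xs i)))"
    by (intro sum.cong refl) (simp add: crp_weight_grow[OF \<gamma> Suc.prems])
  also have "\<dots> = crp_weight \<gamma> xs * (seat (crp_prob \<gamma>) ^^ Suc n) g xs"
    unfolding funpow.simps o_apply by (subst seat_def) (rule sum_distrib_left[symmetric])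
  finally show ?case .
qed

lemma seat_pow_crp_prob_eq_mixture:
  assumes "\<And>xs. \<bar>g xs\<bar> \<le> B"
  shows "(seat (crp_prob \<gamma>) ^^ n) g [1] = (LINT u|P. (seat (sampling_prob (stick_breaking u)) ^^ n) g [1])"
proof -
  have "Gamma \<gamma> \<noteq> 0" using Gamma_real_pos[OF \<gamma>] by linarith
  then have "crp_weight \<gamma> [1] = 1"
    using \<gamma> Gamma_plus1_pos[OF \<gamma>] by (simp add: crp_weight_def add.commute)
  moreover have "stick_weight u [1] = 1" for u
    by (simp add: stick_weight_def)
  ultimately show ?thesis
    using integral_stick_weight_seat_pow[OF assms, of "[1]" n] by simp
qed

text \<open>The expected remaining lengths decay geometrically. Their sum thus has finite mean and
  is almost surely finite, which forces the remainder to 0.\<close>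

lemma AE_stick_breaking_sums: "AE u in P. stick_breaking u sums 1"
proof -
  define R where "R k u = (\<Prod>i<k. 1 - u i)" for k and u :: "nat \<Rightarrow> real"
  have [measurable]: "R k \<in> borel_measurable P" for k
    unfolding R_def by (intro borel_measurable_prod borel_measurable_diff measurable_sticks_component) simp
  have R01: "AE u in P. \<forall>k. 0 \<le> R k u \<and> R k u \<le> 1"
    using AE_sticks by eventually_elim (auto simp: R_def intro!: prod_nonneg prod_le_1 intro: less_imp_le)
  \<comment> \<open>The mean of \<open>1 - u i\<close> for a single stick.\<close>
  define c where "c = Beta 1 (\<gamma> + 1) / Beta 1 \<gamma>"
  have G: "Gamma \<gamma> \<noteq> 0" using Gamma_real_pos[OF \<gamma>] by linarith
  have "c = \<gamma> / (\<gamma> + 1)"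
    using \<gamma> G Gamma_plus1_pos[of \<gamma>] Gamma_plus1_pos[of "\<gamma> + 1"] by (simp add: c_def Beta_def add.commute[of 1])
  then have c: "0 \<le> c" "c < 1"
    using \<gamma> by auto
  have int_R: "(LINT u|P. R k u) = c ^ k" for k
  proof -
    have "(LINT u|P. R k u) = (\<Prod>i<k. LINT x|beta_distribution 1 \<gamma>. 1 - x)"
      unfolding R_def P_def
      by (rule product_prob_space.integral_PiM_prod[OF product_prob_space_sticks]) (use integrable_beta_distribution_monomial[of 1 \<gamma> 0 1] \<gamma> in auto)
    then show ?thesis
      using integral_beta_distribution_monomial[of 1 \<gamma> 0 1] \<gamma> by (simp add: c_def)
  qed
  have "(\<integral>\<^sup>+u. ennreal (R k u) \<partial>P) = ennreal (c ^ k)" for k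
  proof -
    have "integrable P (R k)"
      by (rule P.integrable_const_bound[where B = 1]) (use R01 in auto)
    then show ?thesis
      using R01 by (subst nn_integral_eq_integral) (auto simp: int_R)
  qed
  then have "(\<integral>\<^sup>+u. (\<Sum>k. ennreal (R k u)) \<partial>P) = (\<Sum>k. ennreal (c ^ k))"
    by (subst nn_integral_suminf) auto
  also have "\<dots> < \<infinity>"
    using c by (subst suminf_ennreal2) (auto intro!: summable_geometric)
  finally have "AE u in P. (\<Sum>k. ennreal (R k u)) \<noteq> \<infinity>"
    by (intro nn_integral_PInf_AE) auto
  then show ?thesis
    using R01
  proof eventually_elim
    case (elim u)
    then have "summable (\<lambda>k. R k u)"
      by (intro summable_suminf_not_top) auto
    then have "(\<lambda>k. 1 - R k u) \<longlonglongrightarrow> 1 - 0"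
      by (intro tendsto_diff tendsto_const summable_LIMSEQ_zero)
    then show ?case
      by (simp add: sums_def sum_stick_breaking R_def)
  qed
qed

text \<open>A positive null sequence can be sorted. Strict positivity matters: a zero beside
  infinitely many positive terms could not be placed.\<close>

lemma AE_stick_breaking_rearrangement:
  "AE u in P. is_decreasing_rearrangement (stick_breaking u) (decreasing_rearrangement (stick_breaking u))"
  using AE_stick_breaking_sums AE_sticks
proof eventually_elim
  case (elim u)
  have "finite {j. stick_breaking u i < stick_breaking u j}" for i
  proof -
    have "0 < stick_breaking u i"
      using elim(2) by (auto simp: stick_breaking_def intro!: mult_pos_pos prod_pos)
    moreover have "stick_breaking u \<longlonglongrightarrow> 0"
      using elim(1) by (intro summable_LIMSEQ_zero) (auto simp: sums_iff)
    ultimately have "\<forall>\<^sub>F j in sequentially. stick_breaking u j < stick_breaking u i"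
      by (intro order_tendstoD)
    then obtain N where "\<And>j. j \<ge> N \<Longrightarrow> stick_breaking u j < stick_breaking u i"
      by (auto simp: eventually_sequentially)
    then have "{j. stick_breaking u i < stick_breaking u j} \<subseteq> {..<N}"
      by (auto simp: not_less[symmetric]) (meson less_asym not_less)
    then show ?thesis
      by (rule finite_subset) simp
  qed
  then obtain y where "is_decreasing_rearrangement (stick_breaking u) y"
    using ex_decreasing_rearrangement_iff by blast
  then show ?case
    using decreasing_rearrangement_eqI by metis
qed

lemma seat_pow_crp_prob_tendsto:
  fixes f :: "(nat \<Rightarrow> real) \<Rightarrow> real"
  defines "S \<equiv> {x :: nat \<Rightarrow> real. \<forall>i. 0 \<le> x i}"
  assumes f: "continuous_on S f" and B: "\<And>x. x \<in> S \<Longrightarrow> \<bar>f x\<bar> \<le> B"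
  shows "(\<lambda>n. (seat (crp_prob \<gamma>) ^^ n) (\<lambda>xs. f (\<lambda>i. decreasing_rearrangement (pad xs) i / real n)) [1])
    \<longlonglongrightarrow> (LINT x:S|poisson_dirichlet \<gamma>. f x)"
proof -
  define g where "g n xs = f (\<lambda>i. decreasing_rearrangement (pad xs) i / real n)" for n xs
  have g: "\<bar>g n xs\<bar> \<le> B" for n xs
    unfolding g_def by (rule B) (simp add: S_def decreasing_rearrangement_pad_divide_nonneg)
  \<comment> \<open>\<open>f\<close> is arbitrary off \<open>S\<close>; extension by 0 from the
    closed set \<open>S\<close> makes it Borel.\<close>
  define h where "h x = indicator S x *\<^sub>R f x" for x
  have "closed S"
    unfolding S_def by (rule closed_nonneg_sequences)
  then have h[measurable]: "h \<in> borel_measurable borel"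
    unfolding h_def by (intro borel_measurable_continuous_on_indicator f) auto
  have D[measurable]: "(\<lambda>u. decreasing_rearrangement (stick_breaking u)) \<in> P \<rightarrow>\<^sub>M borel"
    by (rule measurable_compose[OF _ measurable_decreasing_rearrangement],
      rule measurable_coordinatewise_then_product, rule measurable_stick_breaking,
      rule measurable_sticks_component)
  have "(\<lambda>n. LINT u|P. (seat (sampling_prob (stick_breaking u)) ^^ n) (g n) [1])
    \<longlonglongrightarrow> (LINT u|P. h (decreasing_rearrangement (stick_breaking u)))"
  proof (rule integral_dominated_convergence[where w = "\<lambda>_. B"])
    show "AE u in P. (\<lambda>n. (seat (sampling_prob (stick_breaking u)) ^^ n) (g n) [1])
        \<longlonglongrightarrow> h (decreasing_rearrangement (stick_breaking u))"
      using AE_sticks AE_stick_breaking_sums AE_stick_breaking_rearrangement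
    proof eventually_elim
      case (elim u)
      interpret species_weights "stick_breaking u"
        by (rule species_weights_stick_breaking) (use elim in auto)
      let ?D = "decreasing_rearrangement (stick_breaking u)"
      have "?D \<in> S"
        using elim(3) p_nonneg by (auto simp: is_decreasing_rearrangement_def S_def fun_eq_iff)
      then have "h ?D = f ?D"
        by (simp add: h_def)
      moreover have "(\<lambda>n. (seat (sampling_prob (stick_breaking u)) ^^ n) (g n) [1]) \<longlonglongrightarrow> f ?D"
        unfolding g_def
        by (rule seat_pow_rearrangement_tendsto[OF elim(2,3) f[unfolded S_def]])
          (use B in \<open>auto simp: S_def\<close>)
      ultimately show ?case by simp
    qed
    show "AE u in P. norm ((seat (sampling_prob (stick_breaking u)) ^^ n) (g n) [1]) \<le> B" for n
      using AE_sticks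
    proof eventually_elim
      case (elim u)
      interpret species_weights "stick_breaking u"
        by (rule species_weights_stick_breaking) (use elim in auto)
      show ?case
        using seat_pow_abs_le[of "g n" B, OF g] by simp
    qed
  qed (auto intro!: measurable_seat_pow_sampling_prob measurable_stick_breaking measurable_sticks_component)
  also have "(LINT u|P. h (decreasing_rearrangement (stick_breaking u))) = (LINT x:S|poisson_dirichlet \<gamma>. f x)"
    unfolding poisson_dirichlet_def P_def[symmetric] set_lebesgue_integral_def h_def[symmetric]
    by (rule integral_distr[symmetric]) measurable
  finally show ?thesis
    unfolding g_def[symmetric] seat_pow_crp_prob_eq_mixture[OF g] .
qed

end

section \<open>From the expectation operator back to the laws of the chain\<close>

theorem corollary5p1:
  fixes \<gamma> :: real and M :: "'a measure" and X :: "nat \<Rightarrow> 'a \<Rightarrow> nat list"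
  assumes "\<gamma> > 0"
    and "crp_chain M \<gamma> X"
  shows "converges_weakly_on {x :: nat \<Rightarrow> real. \<forall>i. 0 \<le> x i}
           (\<lambda>n. distr M borel
             (\<lambda>\<omega> i. decreasing_rearrangement (pad (X n \<omega>)) i / real n))
           (poisson_dirichlet \<gamma>)"
  unfolding converges_weakly_on_def
proof (intro allI impI)
  fix f :: "(nat \<Rightarrow> real) \<Rightarrow> real"
  define S where "S = {x :: nat \<Rightarrow> real. \<forall>i. 0 \<le> x i}"
  assume f: "continuous_on {x. \<forall>i. 0 \<le> x i} f" and "bounded (f ` {x. \<forall>i. 0 \<le> x i})"
  then obtain B where B: "\<And>x. x \<in> S \<Longrightarrow> \<bar>f x\<bar> \<le> B"
    unfolding S_def bounded_iff by auto
  have "closed S"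
    unfolding S_def by (rule closed_nonneg_sequences)
  then have h: "(\<lambda>x. indicator S x *\<^sub>R f x) \<in> borel_measurable borel"
    using f by (intro borel_measurable_continuous_on_indicator) (auto simp: S_def)
  define \<phi> where "\<phi> n xs i = decreasing_rearrangement (pad xs) i / real n" for n xs i
  have \<phi>: "\<phi> n xs \<in> S" for n xs
    by (simp add: S_def \<phi>_def decreasing_rearrangement_pad_divide_nonneg)
  have "(LINT x:S|distr M borel (\<lambda>\<omega>. \<phi> n (X n \<omega>)). f x) = (seat (crp_prob \<gamma>) ^^ n) (\<lambda>xs. f (\<phi> n xs)) [1]" for n
  proof -
    \<comment> \<open>The state space is discrete, so every function of \<open>X n\<close> is
      measurable and the \<open>distr\<close> in question is the law of the sorted
      frequencies.\<close>
    have "X n \<in> M \<rightarrow>\<^sub>M count_space UNIV"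
      using assms(2) by (simp add: crp_chain_def markov_chain_def)
    then have "(\<lambda>\<omega>. \<phi> n (X n \<omega>)) \<in> M \<rightarrow>\<^sub>M borel"
      by (rule measurable_compose) simp
    then have "(LINT x:S|distr M borel (\<lambda>\<omega>. \<phi> n (X n \<omega>)). f x) = (LINT \<omega>|M. f (\<phi> n (X n \<omega>)))"
      unfolding set_lebesgue_integral_def by (subst integral_distr[OF _ h]) (auto simp: \<phi>)
    also have "\<dots> = (seat (crp_prob \<gamma>) ^^ n) (\<lambda>xs. f (\<phi> n xs)) [1]"
      by (rule crp_chain_integral[OF assms]) (rule B[OF \<phi>])
    finally show ?thesis .
  qed
  then show "(\<lambda>n. LINT x:{x. \<forall>i. 0 \<le> x i}|distr M borel
        (\<lambda>\<omega> i. decreasing_rearrangement (pad (X n \<omega>)) i / real n). f x)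
      \<longlonglongrightarrow> (LINT x:{x. \<forall>i. 0 \<le> x i}|poisson_dirichlet \<gamma>. f x)"
    using seat_pow_crp_prob_tendsto[OF assms(1) f, of B] B
    by (simp add: S_def \<phi>_def[abs_def])
qed

end
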